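(* Let $0<a<b$ and $A=\{x\in\mathbb{R}^2 : a<|x|<b\}$. There exists $\lambda_*>0$ such that, for $\lambda>0$, the problem $$-\Delta u=\lambda\frac{e^{u(x)}}{|x|^2}\ (x\in A),\qquad u(x)=0\ (x\in\partial A)$$ admits no radially symmetric solution for $\lambda>\lambda_*$, exactly one radially symmetric solution for $\lambda=\lambda_*$, and exactly two radially symmetric solutions $\underline{u}_\lambda$ and $U_\lambda$ for $0<\lambda<\lambda_*$. Also, as $\lambda\to+0$, $$\lambda\int_A\frac{e^{\underline{u}_\lambda}}{|x|^2}\,dx\to 0,\qquad \lambda\int_A\frac{e^{U_\lambda}}{|x|^2}\,dx\to+\infty,$$ and $\underline{u}_\lambda\to 0$ uniformly on $\overline{A}$. Define $\delta_\lambda>0$ by $\lambda\,\delta_\lambda^2\,e^{\|U_\lambda\|_{L^\infty(A)}}=1$ and define $$\tilde U_\lambda(t)=U_\lambda\left(e^{-\left(\delta_\lambda t-\frac{\log(ab)}{2}\right)}\right)-\|U_\lambda\|_{L^\infty(A)},\qquad t\in\tilde I_\lambda=\left(-\frac{\log b-\log a}{2\delta_\lambda},\ \frac{\log b-\log a}{2\delta_\lambda}\right).$$ Then, as $\lambda\to+0$, $\delta_\lambda\to 0$ and $$\tilde U_\lambda(t)\to U(t)=\log\frac{4e^{\sqrt2\,t}}{(1+e^{\sqrt2\,t})^2}\quad\text{in } C^1_{loc}(\mathbb{R}).$$ Also, as $\lambda\to+0$, $$\delta_\lambda U_\lambda(|x|)\to 2\sqrt2\,G\left(-\log|x|,\,-\log\sqrt{ab}\right)$$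 uniformly in $C^0(\overline{A})$, where $G(s,t)$ is the Green's function of $-\frac{d^2}{ds^2}$ with the Dirichlet boundary condition on $[\bar a,\bar b]$ with $\bar a=-\log b$, $\bar b=-\log a$.
   Context: For $0<\lambda<\lambda_*$, $\underline{u}_\lambda$ is the minimal (pointwise smaller) radial solution and $U_\lambda$ is the other one. Solutions are understood in the classical sense, $u\in C^2(A)\cap C^0(\overline{A})$; radially symmetric functions are identified with functions of $r=|x|\in[a,b]$. The Green's function of $-\frac{d^2}{ds^2}$ with Dirichlet boundary condition on $[\bar a,\bar b]$ is $$G(s,t)=\frac{1}{\bar b-\bar a}\begin{cases}(s-\bar a)(\bar b-t), & \bar a\le s\le t\le\bar b,\\ (\bar b-s)(t-\bar a), & \bar a\le t\le s\le\bar b.\end{cases}$$ Convergence in $C^1_{loc}(\mathbb{R})$ means: for every compact $K\subset\mathbb{R}$, $K\subset\tilde I_\lambda$ for all sufficiently small $\lambda>0$, and $\tilde U_\lambda\to U$, $\tilde U_\lambda'\to U'$ uniformly on $K$. *)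

theory Defs
  imports "HOL-Analysis.Analysis" "HOL-Probability.Essential_Supremum"
begin

definition partial_deriv :: "'a::euclidean_space \<Rightarrow> ('a \<Rightarrow> real) \<Rightarrow> 'a \<Rightarrow> real" where
  "partial_deriv e f x = frechet_derivative f (at x) e"

text \<open>Intended for open \<open>S\<close>.\<close>

primrec C_k_on :: "nat \<Rightarrow> ('a::euclidean_space \<Rightarrow> real) \<Rightarrow> 'a set \<Rightarrow> bool" where
  "C_k_on 0 f S \<longleftrightarrow> continuous_on S f"
| "C_k_on (Suc k) f S \<longleftrightarrow>
     (\<forall>x\<in>S. f differentiable (at x)) \<and> (\<forall>e\<in>Basis. C_k_on k (partial_deriv e f) S)"

definition laplacian :: "('a::euclidean_space \<Rightarrow> real) \<Rightarrow> 'a \<Rightarrow> real" where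
  "laplacian f x = (\<Sum>e\<in>Basis. partial_deriv e (partial_deriv e f) x)"

definition annulus :: "real \<Rightarrow> real \<Rightarrow> (real^2) set" where
  "annulus a b = {x. a < norm x \<and> norm x < b}"

definition radially_symmetric_on :: "(real^2) set \<Rightarrow> (real^2 \<Rightarrow> real) \<Rightarrow> bool" where
  "radially_symmetric_on S u \<longleftrightarrow> (\<forall>x\<in>S. \<forall>y\<in>S. norm x = norm y \<longrightarrow> u x = u y)"

text \<open>A function on the closed annulus is a HOL function in \<open>extensional (closure (annulus a b))\<close>,
  so that equality of solutions is equality on the closed annulus.  Values outside are irrelevant
  to the equation, which only involves derivatives at points of the open annulus.\<close>

definition radial_solutions :: "real \<Rightarrow> real \<Rightarrow> real \<Rightarrow> (real^2 \<Rightarrow> real) set" where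
  "radial_solutions a b l =
     {u \<in> extensional (closure (annulus a b)).
        C_k_on 2 u (annulus a b) \<and>
        continuous_on (closure (annulus a b)) u \<and>
        radially_symmetric_on (closure (annulus a b)) u \<and>
        (\<forall>x\<in>annulus a b. - laplacian u x = l * (exp (u x) / (norm x)\<^sup>2)) \<and>
        (\<forall>x\<in>frontier (annulus a b). u x = 0)}"

text \<open>The function of \<open>r = |x|\<close> given by a radially symmetric \<open>u\<close>, read off along the positive
  first coordinate axis.\<close>

definition radial_profile :: "(real^2 \<Rightarrow> real) \<Rightarrow> real \<Rightarrow> real" where
  "radial_profile u r = u (r *\<^sub>R axis 1 1)"

definition Linf_norm_on :: "'a::euclidean_space set \<Rightarrow> ('a \<Rightarrow> real) \<Rightarrow> real" where
  "Linf_norm_on S f = real_of_ereal (esssup (lebesgue_on S) (\<lambda>x. ereal \<bar>f x\<bar>))"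

definition rescaled :: "real \<Rightarrow> real \<Rightarrow> (real^2 \<Rightarrow> real) \<Rightarrow> real \<Rightarrow> real \<Rightarrow> real" where
  "rescaled a b u d t =
     radial_profile u (exp (- (d * t - ln (a * b) / 2))) - Linf_norm_on (annulus a b) u"

definition rescaled_interval :: "real \<Rightarrow> real \<Rightarrow> real \<Rightarrow> real set" where
  "rescaled_interval a b d = {- ((ln b - ln a) / (2 * d)) <..< (ln b - ln a) / (2 * d)}"

text \<open>Local \<open>C\<^sup>1\<close> convergence on the line of functions \<open>f l\<close> defined on open sets \<open>I l\<close>.
  Differentiability is stated explicitly because \<open>deriv\<close> is total.\<close>

definition converges_C1_loc ::
  "(real \<Rightarrow> real \<Rightarrow> real) \<Rightarrow> (real \<Rightarrow> real set) \<Rightarrow> (real \<Rightarrow> real) \<Rightarrow> real filter \<Rightarrow> bool" where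
  "converges_C1_loc f I g F \<longleftrightarrow>
     (\<forall>K. compact K \<longrightarrow>
        (\<forall>\<^sub>F l in F. K \<subseteq> I l \<and> (\<forall>t\<in>K. f l differentiable (at t))) \<and>
        uniform_limit K f g F \<and>
        uniform_limit K (\<lambda>l. deriv (f l)) (deriv g) F)"

text \<open>Green's function of \<open>- d\<^sup>2/ds\<^sup>2\<close> on \<open>[p, q]\<close> with Dirichlet boundary condition.\<close>

definition green :: "real \<Rightarrow> real \<Rightarrow> real \<Rightarrow> real \<Rightarrow> real" where
  "green p q s t =
     1 / (q - p) * (if s \<le> t then (s - p) * (q - t) else (q - s) * (t - p))"

end

theory Submission
  imports Defs
begin

text \<open>The problem is explicitly solvable.  In the logarithmic coordinate
  \<open>s = ln (a b) / 2 - ln |x|\<close> the annulus becomes the interval \<open>(-L, L)\<close> with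
  \<open>L = (ln b - ln a) / 2\<close>, and in two dimensions the Laplacian of a radial function is
  \<open>w''(s) / |x|\<^sup>2\<close>.  The factor \<open>|x|\<^sup>2\<close> therefore cancels and the equation is Liouville's
  equation \<open>w'' = - l exp w\<close> with \<open>w (-L) = w L = 0\<close>.

  A solution has a critical point by Rolle's theorem.  The energy \<open>w'\<^sup>2 / 2 + l exp w\<close> is
  constant, and this makes \<open>exp (- w / 2)\<close> a solution of the linear equation
  \<open>z'' = c\<^sup>2 z\<close>, hence a multiple of a shifted \<open>cosh\<close>; the boundary values force the shift to
  vanish.  So the solutions are exactly
  \<open>w s = 2 ln (cosh (c L)) - 2 ln (cosh (c s))\<close> with \<open>c > 0\<close> and \<open>l = 2 (c / cosh (c L))\<^sup>2\<close>
  (\<open>liouville_dirichlet_classification\<close>, carried to the annulus by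
  \<open>radial_solution_classification\<close> and its converse
  \<open>liouville_solution_in_radial_solutions\<close>).

  The function \<open>c / cosh (c L)\<close> rises from 0 to a single maximum and then falls back to 0,
  which gives two, one or no parameters \<open>c\<close> according to the size of \<open>l\<close>
  (\<open>liouville_branches\<close>).  As \<open>l\<close> tends to 0 the smaller parameter tends to 0 and the larger one
  to infinity, so all limits become statements about \<open>c\<close>.  The solution
  increases with \<open>c\<close> and has maximum \<open>2 ln (cosh (c L))\<close>, so the scale \<open>\<delta>\<close> is
  \<open>1 / (sqrt 2 c)\<close>.  The rescaled large solution \<^emph>\<open>equals\<close> the limit profile, which is
  \<open>- 2 ln (cosh (t / sqrt 2))\<close>, on the whole rescaled interval; only the growth of that interval
  matters for the local convergence.  The convergence to Green's function is the elementary
  estimate \<open>|x| - ln 2 \<le> ln (cosh x) \<le> |x|\<close>, since Green's function with its pole at the midpoint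
  is a tent.  The mass is controlled from above by the maximum of the integrand, and from below by
  its values on the annulus \<open>|s| < 1 / c\<close>, where the solution is within a constant of its maximum.\<close>

section \<open>The Laplacian of a function of the logarithm of the radius\<close>

lemma has_derivative_log_polar:
  fixes x :: "'a::euclidean_space"
  assumes "x \<noteq> 0" and "(\<phi> has_real_derivative d) (at (k - ln (norm x)))"
  shows "((\<lambda>y. \<phi> (k - ln (norm y))) has_derivative (\<lambda>h. - d * (x \<bullet> h) / (x \<bullet> x))) (at x)"
proof -
  have "((\<lambda>y. k - ln (norm y)) has_derivative (\<lambda>h. - ((x \<bullet> h) / (x \<bullet> x)))) (at x)"
    using assms(1)
    by (auto intro!: derivative_eq_intros has_derivative_norm
        simp: sgn_div_norm fun_eq_iff inner_commute dot_square_norm power2_eq_square field_simps)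
  from has_derivative_compose[OF this assms(2)[unfolded has_field_derivative_def]]
  show ?thesis by (simp add: mult.assoc)
qed

lemma partial_deriv_eqI: "(f has_derivative D) (at x) \<Longrightarrow> partial_deriv e f x = D e"
  unfolding partial_deriv_def by (metis frechet_derivative_at)

context
  fixes S :: "'a::euclidean_space set" and u :: "'a \<Rightarrow> real"
    and \<phi> \<phi>' \<phi>'' :: "real \<Rightarrow> real" and k :: real
  assumes S: "open S" "0 \<notin> S"
    and u: "\<And>x. x \<in> S \<Longrightarrow> u x = \<phi> (k - ln (norm x))"
    and \<phi>': "\<And>x. x \<in> S \<Longrightarrow>
          (\<phi> has_real_derivative \<phi>' (k - ln (norm x))) (at (k - ln (norm x)))"
    and \<phi>'': "\<And>x. x \<in> S \<Longrightarrow>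
          (\<phi>' has_real_derivative \<phi>'' (k - ln (norm x))) (at (k - ln (norm x)))"
begin

lemma log_polar_has_derivative:
  assumes "x \<in> S"
  shows "(u has_derivative (\<lambda>h. - \<phi>' (k - ln (norm x)) * (x \<bullet> h) / (x \<bullet> x))) (at x)"
proof (rule has_derivative_transform_within_open[OF _ S(1) assms])
  show "((\<lambda>y. \<phi> (k - ln (norm y))) has_derivative
      (\<lambda>h. - \<phi>' (k - ln (norm x)) * (x \<bullet> h) / (x \<bullet> x))) (at x)"
    using assms S(2) by (intro has_derivative_log_polar \<phi>') auto
qed (simp add: u)

text \<open>The second derivative is taken of \<open>partial_deriv e u\<close>, which agrees with the explicit formula
  \<open>- \<phi>' (k - ln |x|) (x \<bullet> e) / |x|\<^sup>2\<close> only on the open set \<open>S\<close>.\<close>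

lemma log_polar_second_derivative:
  assumes "x \<in> S"
  shows "(partial_deriv e u has_derivative
           (\<lambda>h. \<phi>'' (k - ln (norm x)) * (x \<bullet> h) * (x \<bullet> e) / (x \<bullet> x)\<^sup>2
              - \<phi>' (k - ln (norm x)) * ((h \<bullet> e) / (x \<bullet> x) - 2 * (x \<bullet> e) * (x \<bullet> h) / (x \<bullet> x)\<^sup>2)))
         (at x)"
proof (rule has_derivative_transform_within_open[OF _ S(1) assms])
  fix y assume "y \<in> S"
  show "- \<phi>' (k - ln (norm y)) * ((y \<bullet> e) / (y \<bullet> y)) = partial_deriv e u y"
    by (subst partial_deriv_eqI[OF log_polar_has_derivative[OF \<open>y \<in> S\<close>]]) simp
next
  have x: "x \<noteq> 0" using assms S(2) by auto
  have 1: "((\<lambda>y. (y \<bullet> e) / (y \<bullet> y)) has_derivative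
          (\<lambda>h. (h \<bullet> e) / (x \<bullet> x) - 2 * (x \<bullet> e) * (x \<bullet> h) / (x \<bullet> x)\<^sup>2)) (at x)"
    using x by (auto intro!: derivative_eq_intros
        simp: fun_eq_iff inner_commute power2_eq_square field_simps)
  have 2: "((\<lambda>y. \<phi>' (k - ln (norm y))) has_derivative
      (\<lambda>h. - \<phi>'' (k - ln (norm x)) * (x \<bullet> h) / (x \<bullet> x))) (at x)"
    by (rule has_derivative_log_polar[OF x \<phi>''[OF assms]])
  have "((\<lambda>y. - (\<phi>' (k - ln (norm y)) * ((y \<bullet> e) / (y \<bullet> y)))) has_derivative
           (\<lambda>h. - (\<phi>' (k - ln (norm x)) * ((h \<bullet> e) / (x \<bullet> x) - 2 * (x \<bullet> e) * (x \<bullet> h) / (x \<bullet> x)\<^sup>2)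
             + - \<phi>'' (k - ln (norm x)) * (x \<bullet> h) / (x \<bullet> x) * ((x \<bullet> e) / (x \<bullet> x))))) (at x)"
    by (rule has_derivative_minus[OF has_derivative_mult[OF 2 1]])
  moreover have "(\<lambda>h. - (\<phi>' (k - ln (norm x)) * ((h \<bullet> e) / (x \<bullet> x) - 2 * (x \<bullet> e) * (x \<bullet> h) / (x \<bullet> x)\<^sup>2)
             + - \<phi>'' (k - ln (norm x)) * (x \<bullet> h) / (x \<bullet> x) * ((x \<bullet> e) / (x \<bullet> x))))
      = (\<lambda>h. \<phi>'' (k - ln (norm x)) * (x \<bullet> h) * (x \<bullet> e) / (x \<bullet> x)\<^sup>2
         - \<phi>' (k - ln (norm x)) * ((h \<bullet> e) / (x \<bullet> x) - 2 * (x \<bullet> e) * (x \<bullet> h) / (x \<bullet> x)\<^sup>2))"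
    by (rule ext) (simp add: power2_eq_square)
  ultimately show "((\<lambda>y. - \<phi>' (k - ln (norm y)) * ((y \<bullet> e) / (y \<bullet> y))) has_derivative
      (\<lambda>h. \<phi>'' (k - ln (norm x)) * (x \<bullet> h) * (x \<bullet> e) / (x \<bullet> x)\<^sup>2
         - \<phi>' (k - ln (norm x)) * ((h \<bullet> e) / (x \<bullet> x) - 2 * (x \<bullet> e) * (x \<bullet> h) / (x \<bullet> x)\<^sup>2))) (at x)"
    by (simp only: mult_minus_left)
qed

text \<open>In the coordinate \<open>k - ln |x|\<close> the first-order term carries the factor \<open>DIM('a) - 2\<close>, because
  the derivatives of \<open>x / |x|\<^sup>2\<close> have trace \<open>(DIM('a) - 2) / |x|\<^sup>2\<close>.  In the plane it drops out.\<close>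

lemma log_polar_laplacian:
  assumes "x \<in> S"
  shows "laplacian u x =
    (\<phi>'' (k - ln (norm x)) - (real DIM('a) - 2) * \<phi>' (k - ln (norm x))) / (norm x)\<^sup>2"
proof -
  have x: "x \<bullet> x \<noteq> 0" using assms S(2) by auto
  have sq: "(\<Sum>e\<in>Basis. (x \<bullet> e) * (x \<bullet> e)) = x \<bullet> x"
    by (rule euclidean_inner[symmetric])
  let ?p = "\<phi>' (k - ln (norm x))" and ?q = "\<phi>'' (k - ln (norm x))"
  have "laplacian u x = (\<Sum>e\<in>Basis. ?q / (x \<bullet> x)\<^sup>2 * ((x \<bullet> e) * (x \<bullet> e))
      - ?p / (x \<bullet> x) + 2 * ?p / (x \<bullet> x)\<^sup>2 * ((x \<bullet> e) * (x \<bullet> e)))"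
    unfolding laplacian_def
  proof (rule sum.cong[OF refl])
    fix e :: 'a assume "e \<in> Basis"
    then show "partial_deriv e (partial_deriv e u) x = ?q / (x \<bullet> x)\<^sup>2 * ((x \<bullet> e) * (x \<bullet> e))
      - ?p / (x \<bullet> x) + 2 * ?p / (x \<bullet> x)\<^sup>2 * ((x \<bullet> e) * (x \<bullet> e))"
      by (subst partial_deriv_eqI[OF log_polar_second_derivative[OF assms]])
         (simp add: algebra_simps)
  qed
  also have "\<dots> = ?q / (x \<bullet> x)\<^sup>2 * (x \<bullet> x) - DIM('a) * (?p / (x \<bullet> x)) + 2 * ?p / (x \<bullet> x)\<^sup>2 * (x \<bullet> x)"
    unfolding sum.distrib sum_subtractf sum_distrib_left[symmetric] sq by simp
  also have "\<dots> = (?q - (real DIM('a) - 2) * ?p) / (x \<bullet> x)"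
    using x by (simp add: field_simps power2_eq_square)
  finally show ?thesis by (simp add: dot_square_norm)
qed

lemma log_polar_C_2:
  assumes cont: "continuous_on ((\<lambda>x. k - ln (norm x)) ` S) \<phi>''"
  shows "C_k_on 2 u S"
proof -
  have "continuous_on ((\<lambda>x. k - ln (norm x)) ` S) \<phi>'"
    by (rule DERIV_continuous_on[where D = \<phi>''])
       (use \<phi>'' has_field_derivative_at_within in blast)
  moreover have s: "continuous_on S (\<lambda>x. k - ln (norm x))"
    using S(2) by (intro continuous_intros) auto
  ultimately have "continuous_on S (\<lambda>x. \<phi>' (k - ln (norm x)))"
    using continuous_on_compose2 by blast
  moreover have "continuous_on S (\<lambda>x. \<phi>'' (k - ln (norm x)))"
    using continuous_on_compose2[OF cont s] by blast
  moreover have "(x \<bullet> x) \<noteq> 0" if "x \<in> S" for x using that S(2) by auto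
  ultimately have "continuous_on S (\<lambda>x. \<phi>'' (k - ln (norm x)) * (x \<bullet> h) * (x \<bullet> e) / (x \<bullet> x)\<^sup>2
        - \<phi>' (k - ln (norm x)) * ((h \<bullet> e) / (x \<bullet> x) - 2 * (x \<bullet> e) * (x \<bullet> h) / (x \<bullet> x)\<^sup>2))" for e h
    by (intro continuous_intros) auto
  then have "continuous_on S (partial_deriv h (partial_deriv e u))" for e h
    by (rule continuous_on_eq) (simp add: partial_deriv_eqI[OF log_polar_second_derivative])
  moreover have "u differentiable (at x)" "partial_deriv e u differentiable (at x)"
    if "x \<in> S" for x e
    using log_polar_has_derivative[OF that] log_polar_second_derivative[OF that]
    unfolding differentiable_def by blast+
  ultimately show ?thesis by (simp add: numeral_2_eq_2)
qed

end

section \<open>The Liouville equation on a symmetric interval\<close>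

text \<open>The solution of \<open>w'' = - 2 (c / cosh (c L))\<^sup>2 exp w\<close> with zero boundary values at \<open>-L\<close> and \<open>L\<close>;
  the parameter \<open>c\<close> determines its height \<open>2 ln (cosh (c L))\<close>.\<close>

definition liouville_profile :: "real \<Rightarrow> real \<Rightarrow> real \<Rightarrow> real" where
  "liouville_profile L c s = 2 * ln (cosh (c * L)) - 2 * ln (cosh (c * s))"

lemma liouville_profile_deriv:
  "(liouville_profile L c has_real_derivative - 2 * c * tanh (c * s)) (at s)"
  unfolding liouville_profile_def [abs_def]
  by (auto intro!: derivative_eq_intros simp: tanh_def field_simps)

lemma liouville_profile_deriv2:
  "((\<lambda>s. - 2 * c * tanh (c * s)) has_real_derivative
      - (2 * (c / cosh (c * L))\<^sup>2) * exp (liouville_profile L c s)) (at s)"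
proof -
  have "exp (liouville_profile L c s) = (cosh (c * L) / cosh (c * s))\<^sup>2"
    by (simp add: liouville_profile_def exp_diff exp_double power_divide)
  moreover have "1 - (tanh (c * s))\<^sup>2 = 1 / (cosh (c * s))\<^sup>2"
    using diff_divide_distrib[of "(cosh (c * s))\<^sup>2" "(sinh (c * s))\<^sup>2" "(cosh (c * s))\<^sup>2"]
    by (simp add: tanh_def power_divide hyperbolic_pythagoras)
  ultimately show ?thesis
    by (auto intro!: derivative_eq_intros simp: power_divide power_mult_distrib power2_eq_square)
qed

text \<open>The operator \<open>D\<^sup>2 - c\<^sup>2\<close> factors as \<open>(D - c) (D + c)\<close>, so each of \<open>z' - c z\<close> and
  \<open>z' + c z\<close> solves a first-order equation and is an exponential determined by its value at \<open>t\<close>.\<close>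

lemma linear_ode_cosh_unique:
  fixes z z' :: "real \<Rightarrow> real" and J :: "real set"
  assumes J: "convex J" "t \<in> J"
    and z: "\<And>s. s \<in> J \<Longrightarrow> (z has_real_derivative z' s) (at s)"
    and z': "\<And>s. s \<in> J \<Longrightarrow> (z' has_real_derivative c\<^sup>2 * z s) (at s)"
    and "z' t = 0" "c \<noteq> 0" "s \<in> J"
  shows "z s = z t * cosh (c * (s - t))"
proof -
  have const: "(z' s - k * z s) * exp (k * (s - t)) = - k * z t" if "k\<^sup>2 = c\<^sup>2" for k
  proof -
    have "((\<lambda>s. (z' s - k * z s) * exp (k * (s - t))) has_real_derivative 0) (at r within J)"
      if "r \<in> J" for r
      using z[OF that] z'[OF that] \<open>k\<^sup>2 = c\<^sup>2\<close>
      by (auto intro!: derivative_eq_intros has_field_derivative_at_within[where s = J]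
          simp: power2_eq_square algebra_simps)
    from has_field_derivative_zero_constant[OF J(1) this]
    obtain C where "\<forall>r\<in>J. (z' r - k * z r) * exp (k * (r - t)) = C" by blast
    with J(2) \<open>s \<in> J\<close> have "(z' s - k * z s) * exp (k * (s - t))
        = (z' t - k * z t) * exp (k * (t - t))" by metis
    with \<open>z' t = 0\<close> show ?thesis by simp
  qed
  define e where "e = exp (c * (s - t))"
  have "e > 0" by (simp add: e_def)
  have "(z' s - c * z s) * e = - c * z t" using const[of c] by (simp add: e_def)
  moreover have "(z' s + c * z s) / e = c * z t"
    using const[of "- c"] exp_minus[of "c * (s - t)"] by (simp add: divide_inverse e_def)
  ultimately have "z' s - c * z s = - c * z t / e" "z' s + c * z s = c * z t * e"
    using \<open>e > 0\<close> by (simp_all add: field_simps)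
  then have "2 * c * z s = c * z t * e + c * z t / e" by simp
  also have "\<dots> = 2 * c * (z t * ((e + inverse e) / 2))" using \<open>e > 0\<close> by (simp add: field_simps)
  finally show ?thesis using \<open>c \<noteq> 0\<close> by (simp add: cosh_def exp_minus e_def)
qed

text \<open>At a critical point \<open>t\<close> the conserved energy equals \<open>l exp (w t)\<close>, which is named
  \<open>2 c\<^sup>2\<close>.  With it, \<open>z = exp (- w / 2)\<close> satisfies \<open>z'' = (w'\<^sup>2 / 4 - w'' / 2) z = c\<^sup>2 z\<close>, and the
  nonlinear problem has become linear.\<close>

lemma liouville_dirichlet_classification:
  fixes w w' :: "real \<Rightarrow> real"
  assumes "0 < L" "0 < l"
    and w: "\<And>s. s \<in> {-L<..<L} \<Longrightarrow> (w has_real_derivative w' s) (at s)"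
    and w': "\<And>s. s \<in> {-L<..<L} \<Longrightarrow> (w' has_real_derivative - l * exp (w s)) (at s)"
    and cont: "continuous_on {-L..L} w" and bc: "w (-L) = 0" "w L = 0"
  shows "\<exists>c>0. l = 2 * (c / cosh (c * L))\<^sup>2 \<and> (\<forall>s\<in>{-L..L}. w s = liouville_profile L c s)"
proof -
  have "\<exists>z. -L < z \<and> z < L \<and> DERIV w z :> 0"
    using \<open>0 < L\<close> bc cont w
    by (intro Rolle) (auto simp: real_differentiable_def)
  then obtain t where t: "t \<in> {-L<..<L}" "w' t = 0"
    using w DERIV_unique by force
  define c where "c = sqrt (l / 2) * exp (w t / 2)"
  have "c > 0" using \<open>0 < l\<close> by (simp add: c_def)
  have c2: "2 * c\<^sup>2 = l * exp (w t)"
    using \<open>0 < l\<close> by (simp add: c_def power_mult_distrib flip: exp_double)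
  \<comment> \<open>the energy, with the value of the constant read off at the critical point \<open>t\<close>\<close>
  have energy: "(w' s)\<^sup>2 / 2 + l * exp (w s) = 2 * c\<^sup>2" if "s \<in> {-L<..<L}" for s
  proof -
    have "((\<lambda>s. (w' s)\<^sup>2 / 2 + l * exp (w s)) has_real_derivative 0) (at r within {-L<..<L})"
      if "r \<in> {-L<..<L}" for r
      using w[OF that] w'[OF that]
      by (auto intro!: derivative_eq_intros has_field_derivative_at_within[where s = "{-L<..<L}"])
    from has_field_derivative_zero_constant[OF convex_real_interval(8) this]
    obtain C where "\<forall>r\<in>{-L<..<L}. (w' r)\<^sup>2 / 2 + l * exp (w r) = C" by blast
    then have "(w' s)\<^sup>2 / 2 + l * exp (w s) = (w' t)\<^sup>2 / 2 + l * exp (w t)"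
      using that t(1) by metis
    with t(2) c2 show ?thesis by simp
  qed
  have open_eq: "w s = w t - 2 * ln (cosh (c * (s - t)))" if s: "s \<in> {-L<..<L}" for s
  proof -
    define z where "z r = exp (- w r / 2)" for r
    define z' where "z' r = - w' r / 2 * z r" for r
    have "(z has_real_derivative z' r) (at r)" if "r \<in> {-L<..<L}" for r
      using w[OF that] unfolding z_def z'_def by (auto intro!: derivative_eq_intros)
    moreover have "(z' has_real_derivative c\<^sup>2 * z r) (at r)" if "r \<in> {-L<..<L}" for r
    proof -
      have "(z' has_real_derivative ((w' r)\<^sup>2 / 2 + l * exp (w r)) / 2 * z r) (at r)"
        using w[OF that] w'[OF that] unfolding z'_def z_def
        by (auto intro!: derivative_eq_intros simp: power2_eq_square field_simps)
      then show ?thesis using energy[OF that] by simp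
    qed
    moreover have "z' t = 0" using t(2) by (simp add: z'_def)
    ultimately have "z s = z t * cosh (c * (s - t))"
      using \<open>c > 0\<close> s t(1) by (intro linear_ode_cosh_unique[where J = "{-L<..<L}" and z' = z']) auto
    then have "ln (z s) = ln (z t) + ln (cosh (c * (s - t)))"
      by (simp add: ln_mult z_def)
    then show ?thesis by (simp add: z_def)
  qed
  have closed_eq: "w s = w t - 2 * ln (cosh (c * (s - t)))" if s: "s \<in> {-L..L}" for s
  proof -
    have "w s - (w t - 2 * ln (cosh (c * (s - t)))) = 0"
    proof (rule continuous_constant_on_closure[where S = "{-L<..<L}" and
          f = "\<lambda>s. w s - (w t - 2 * ln (cosh (c * (s - t))))"])
      show "continuous_on (closure {-L<..<L}) (\<lambda>s. w s - (w t - 2 * ln (cosh (c * (s - t)))))"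
        using cont \<open>0 < L\<close> by (auto intro!: continuous_intros)
    qed (use open_eq s \<open>0 < L\<close> in auto)
    then show ?thesis by simp
  qed
  \<comment> \<open>equal boundary values place the critical point at the midpoint\<close>
  have "cosh (c * (- L - t)) = cosh (c * (L - t))"
    using closed_eq[of "-L"] closed_eq[of L] bc \<open>0 < L\<close> by simp
  then have "\<bar>c * (- L - t)\<bar> = \<bar>c * (L - t)\<bar>" by simp
  with \<open>c > 0\<close> have "\<bar>- L - t\<bar> = \<bar>L - t\<bar>" by (simp add: abs_mult)
  with \<open>0 < L\<close> have "t = 0" by auto
  then have wt: "w t = 2 * ln (cosh (c * L))"
    using closed_eq[of L] bc \<open>0 < L\<close> by simp
  then have "exp (w t) = (cosh (c * L))\<^sup>2" by (simp add: exp_double)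
  with c2 have "l = 2 * (c / cosh (c * L))\<^sup>2" by (simp add: power_divide field_simps)
  with \<open>c > 0\<close> closed_eq \<open>t = 0\<close> wt show ?thesis
    by (auto simp: liouville_profile_def intro!: exI[of _ c])
qed

section \<open>The turning point of the solution curve\<close>

lemma mult_tanh_strict_mono:
  fixes x y :: real
  assumes "0 \<le> x" "x < y"
  shows "x * tanh x < y * tanh y"
proof -
  have "x * tanh x \<le> x * tanh y"
    using assms by (intro mult_left_mono) auto
  also have "\<dots> < y * tanh y" using assms by simp
  finally show ?thesis .
qed

lemma mult_tanh_eq_1_exists: "\<exists>\<theta>>0::real. \<theta> * tanh \<theta> = 1"
proof -
  \<comment> \<open>this bound gives \<open>1 \<le> 2 tanh 2\<close>, so the value 1 is taken between 0 and 2\<close>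
  have "exp (-4::real) \<le> 1 / 5"
    using exp_ge_add_one_self[of 4] by (simp add: exp_minus field_simps)
  then have "1 \<le> 2 * tanh (2::real)"
    by (simp add: tanh_real_altdef pos_le_divide_eq add_pos_pos)
  moreover have "continuous_on {0..2::real} (\<lambda>\<theta>. \<theta> * tanh \<theta>)"
    by (intro continuous_intros) auto
  ultimately obtain \<theta> :: real where \<theta>: "0 \<le> \<theta>" "\<theta> * tanh \<theta> = 1"
    using IVT'[of "\<lambda>\<theta>::real. \<theta> * tanh \<theta>" 0 1 2] by auto
  then have "\<theta> \<noteq> 0" by auto
  with \<theta> show ?thesis by (intro exI[of _ \<theta>]) simp
qed

lemma divide_cosh_deriv:
  "((\<lambda>c. c / cosh (c * L)) has_real_derivative (1 - c * L * tanh (c * L)) / cosh (c * L)) (at c)"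
  by (auto intro!: derivative_eq_intros simp: tanh_def power2_eq_square field_simps)

lemma continuous_on_divide_cosh: "continuous_on A (\<lambda>c::real. c / cosh (c * L))"
  by (intro continuous_intros) auto

text \<open>The sign of the derivative of \<open>c / cosh (c L)\<close> is that of \<open>1 - \<theta> tanh \<theta>\<close> with
  \<open>\<theta> = c L\<close>, and \<open>\<theta> tanh \<theta>\<close> increases strictly through the value 1.\<close>

lemma divide_cosh_turning_point:
  assumes "0 < L"
  obtains m :: real where "0 < m"
    and "strict_mono_on {0..m} (\<lambda>c. c / cosh (c * L))"
    and "strict_antimono_on {m..} (\<lambda>c. c / cosh (c * L))"
proof -
  obtain \<theta> :: real where \<theta>: "\<theta> > 0" "\<theta> * tanh \<theta> = 1" using mult_tanh_eq_1_exists by blast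
  let ?h = "\<lambda>c. c / cosh (c * L)" and ?m = "\<theta> / L"
  have "strict_mono_on {0..?m} ?h"
  proof (rule strict_mono_onI)
    fix r s assume rs: "r \<in> {0..?m}" "s \<in> {0..?m}" "r < s"
    show "?h r < ?h s"
    proof (rule DERIV_pos_imp_increasing_open[OF rs(3) _ continuous_on_divide_cosh])
      fix c assume "r < c" "c < s"
      then have "c * L < s * L" "0 \<le> c * L" "s * L \<le> \<theta>"
        using rs assms by (auto simp: field_simps)
      then have "0 \<le> c * L" "c * L < \<theta>" by auto
      from mult_tanh_strict_mono[OF this] \<theta>
      have "0 < (1 - c * L * tanh (c * L)) / cosh (c * L)" by simp
      then show "\<exists>y. DERIV ?h c :> y \<and> 0 < y" using divide_cosh_deriv by blast
    qed
  qed
  moreover have "strict_antimono_on {?m..} ?h"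
  proof (rule monotone_onI)
    fix r s assume rs: "r \<in> {?m..}" "s \<in> {?m..}" "r < s"
    show "?h s < ?h r"
    proof (rule DERIV_neg_imp_decreasing_open[OF rs(3) _ continuous_on_divide_cosh])
      fix c assume "r < c" "c < s"
      then have "r * L < c * L" "\<theta> \<le> r * L" using rs assms by (auto simp: field_simps)
      then have "\<theta> < c * L" by simp
      with mult_tanh_strict_mono[OF _ this] \<theta>
      have "(1 - c * L * tanh (c * L)) / cosh (c * L) < 0" by (simp add: divide_neg_pos)
      then show "\<exists>y. DERIV ?h c :> y \<and> y < 0" using divide_cosh_deriv by blast
    qed
  qed
  ultimately show ?thesis using that[of ?m] \<theta>(1) assms by simp
qed

lemma divide_cosh_le:
  fixes c L :: real
  assumes "0 < L" "0 < c"
  shows "c / cosh (c * L) \<le> 4 / (c * L\<^sup>2)"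
proof -
  have "(c * L)\<^sup>2 / 2 \<le> exp (c * L)"
    using exp_lower_Taylor_quadratic[of "c * L"] mult_pos_pos[OF assms(2,1)] by linarith
  also have "\<dots> \<le> 2 * cosh (c * L)" by (simp add: cosh_def)
  finally have "c * (c * L\<^sup>2) \<le> 4 * cosh (c * L)" by (simp add: power2_eq_square mult_ac)
  then show ?thesis using assms by (simp add: field_simps)
qed

text \<open>The levels of a function that rises strictly from 0 to a peak at \<open>m\<close> and then falls strictly to
  0.  Monotonicity on each side also gives the limits of the two branches: if \<open>v\<close> is below the
  value at \<open>r < m\<close>, the left branch lies below \<open>r\<close>, and similarly on the right.\<close>

lemma divide_cosh_two_branches:
  assumes L: "0 < L"
  obtains m :: real and c1 c2 :: "real \<Rightarrow> real" where "0 < m"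
    and "\<And>c. 0 < c \<Longrightarrow> c \<noteq> m \<Longrightarrow> c / cosh (c * L) < m / cosh (m * L)"
    and "\<And>v. 0 < v \<Longrightarrow> v < m / cosh (m * L) \<Longrightarrow>
           0 < c1 v \<and> c1 v < c2 v \<and> {c. 0 < c \<and> c / cosh (c * L) = v} = {c1 v, c2 v}"
    and "(c1 \<longlongrightarrow> 0) (at_right 0)" and "filterlim c2 at_top (at_right 0)"
proof -
  define h where "h c = c / cosh (c * L)" for c
  obtain m where m: "0 < m" and inc: "strict_mono_on {0..m} h"
    and dec: "strict_antimono_on {m..} h"
    using divide_cosh_turning_point[OF L] unfolding h_def [abs_def] by blast
  have incD: "h r < h s" if "0 \<le> r" "r < s" "s \<le> m" for r s
    using inc that by (auto simp: monotone_on_def)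
  have decD: "h s < h r" if "m \<le> r" "r < s" for r s
    using dec that by (auto simp: monotone_on_def)
  have hpos: "0 < h c" if "0 < c" for c using that by (simp add: h_def)
  have cont: "continuous_on A h" for A
    unfolding h_def [abs_def] by (rule continuous_on_divide_cosh)
  have small: "\<exists>c. 0 < c \<and> c < m \<and> h c = v" if v: "0 < v" "v < h m" for v
  proof -
    have "h 0 = 0" by (simp add: h_def)
    then obtain c where c: "0 \<le> c" "c \<le> m" "h c = v"
      using IVT'[of h 0 v m, OF _ _ _ cont] v m by auto
    then have "c \<noteq> 0" "c \<noteq> m" using v \<open>h 0 = 0\<close> by auto
    with c show ?thesis by (intro exI[of _ c]) auto
  qed
  have large: "\<exists>c. m < c \<and> h c = v" if v: "0 < v" "v < h m" for v
  proof -
    \<comment> \<open>chosen so that \<open>h d \<le> 4 / (d L\<^sup>2) \<le> v\<close>\<close>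
    define d where "d = max m (4 / (L\<^sup>2 * v))"
    have "0 < d" "m \<le> d" using m by (auto simp: d_def)
    have "h d \<le> 4 / (d * L\<^sup>2)" using divide_cosh_le[OF L \<open>0 < d\<close>] by (simp add: h_def)
    also have "\<dots> \<le> v"
    proof -
      have "4 / (L\<^sup>2 * v) \<le> d" by (simp add: d_def)
      then show ?thesis using \<open>0 < d\<close> L v by (simp add: field_simps)
    qed
    finally obtain c where c: "m \<le> c" "h c = v"
      using IVT2'[of h d v m, OF _ _ _ cont] v \<open>m \<le> d\<close> by auto
    with v have "c \<noteq> m" by auto
    with c show ?thesis by (intro exI[of _ c]) auto
  qed
  obtain c1 where c1: "\<And>v. 0 < v \<Longrightarrow> v < h m \<Longrightarrow> 0 < c1 v \<and> c1 v < m \<and> h (c1 v) = v"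
    using small by metis
  obtain c2 where c2: "\<And>v. 0 < v \<Longrightarrow> v < h m \<Longrightarrow> m < c2 v \<and> h (c2 v) = v"
    using large by metis
  have peak: "h c < h m" if "0 < c" "c \<noteq> m" for c
    using incD[of c m] decD[of m c] that by linarith
  have branches: "{c. 0 < c \<and> h c = v} = {c1 v, c2 v}" if v: "0 < v" "v < h m" for v
  proof -
    have "c = c1 v" if "0 < c" "h c = v" "c \<le> m" for c
      using incD[of c "c1 v"] incD[of "c1 v" c] c1[OF v] that
      by (cases c "c1 v" rule: linorder_cases) auto
    moreover have "c = c2 v" if "h c = v" "m < c" for c
      using decD[of c "c2 v"] decD[of "c2 v" c] c2[OF v] that
      by (cases c "c2 v" rule: linorder_cases) auto
    moreover have "0 < c2 v" using c2[OF v] m by linarith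
    ultimately show ?thesis using c1[OF v] c2[OF v]
      by (intro set_eqI iffI) (auto simp: not_le [symmetric])
  qed
  have "(c1 \<longlongrightarrow> 0) (at_right 0)"
  proof (rule tendstoI)
    fix \<epsilon> :: real assume "0 < \<epsilon>"
    define r where "r = min \<epsilon> m"
    have r: "0 < r" "r \<le> m" "r \<le> \<epsilon>" using \<open>0 < \<epsilon>\<close> m by (auto simp: r_def)
    have "\<forall>\<^sub>F v in at_right 0. 0 < v \<and> v < h r"
      using hpos[OF r(1)] by (auto simp: eventually_at_right)
    then show "\<forall>\<^sub>F v in at_right 0. dist (c1 v) 0 < \<epsilon>"
    proof eventually_elim
      case (elim v)
      then have "v < h m" using incD[of r m] r by (cases "r = m") auto
      with elim have "0 < c1 v" "c1 v < m" "h (c1 v) = v" using c1 by auto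
      moreover have "c1 v < r"
        using incD[of r "c1 v"] elim calculation r by (cases "c1 v" r rule: linorder_cases) auto
      ultimately show ?case using r by (simp add: dist_real_def)
    qed
  qed
  moreover have "filterlim c2 at_top (at_right 0)"
    unfolding filterlim_at_top
  proof
    fix Z :: real
    define r where "r = max Z m"
    have r: "0 < r" "m \<le> r" "Z \<le> r" using m by (auto simp: r_def)
    have "\<forall>\<^sub>F v in at_right 0. 0 < v \<and> v < h r"
      using hpos[OF r(1)] by (auto simp: eventually_at_right)
    then show "\<forall>\<^sub>F v in at_right 0. Z \<le> c2 v"
    proof eventually_elim
      case (elim v)
      then have "v < h m" using decD[of m r] r by (cases "r = m") auto
      with elim have "m < c2 v" "h (c2 v) = v" using c2 by auto
      then have "r \<le> c2 v" using decD[of "c2 v" r] elim by (cases "r \<le> c2 v") auto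
      with r show ?case by simp
    qed
  qed
  moreover have "0 < c1 v \<and> c1 v < c2 v \<and> {c. 0 < c \<and> h c = v} = {c1 v, c2 v}"
    if "0 < v" "v < h m" for v
    using branches[OF that] c1[OF that] c2[OF that] by simp
  ultimately show ?thesis using that[of m c1 c2] m peak unfolding h_def [abs_def] by blast
qed

text \<open>The passage from \<open>c / cosh (c L)\<close> to the eigenvalue \<open>2 (c / cosh (c L))\<^sup>2\<close>: the branches are
  those of \<open>divide_cosh_two_branches\<close> at the level \<open>sqrt (l / 2)\<close>.\<close>

lemma liouville_branches:
  assumes L: "0 < L"
  obtains lstar :: real and C1 C2 :: "real \<Rightarrow> real" where "0 < lstar"
    and "\<And>l. lstar < l \<Longrightarrow> {c. 0 < c \<and> 2 * (c / cosh (c * L))\<^sup>2 = l} = {}"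
    and "\<exists>m. {c. 0 < c \<and> 2 * (c / cosh (c * L))\<^sup>2 = lstar} = {m}"
    and "\<And>l. 0 < l \<Longrightarrow> l < lstar \<Longrightarrow> 0 < C1 l \<and> C1 l < C2 l \<and>
           {c. 0 < c \<and> 2 * (c / cosh (c * L))\<^sup>2 = l} = {C1 l, C2 l}"
    and "(C1 \<longlongrightarrow> 0) (at_right 0)" and "filterlim C2 at_top (at_right 0)"
proof -
  obtain m :: real and c1 c2 :: "real \<Rightarrow> real" where m: "0 < m"
    and peak: "\<And>c. 0 < c \<Longrightarrow> c \<noteq> m \<Longrightarrow> c / cosh (c * L) < m / cosh (m * L)"
    and c12: "\<And>v. 0 < v \<Longrightarrow> v < m / cosh (m * L) \<Longrightarrow>
           0 < c1 v \<and> c1 v < c2 v \<and> {c. 0 < c \<and> c / cosh (c * L) = v} = {c1 v, c2 v}"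
    and lim: "(c1 \<longlongrightarrow> 0) (at_right 0)" "filterlim c2 at_top (at_right 0)"
    by (rule divide_cosh_two_branches[OF L]) blast
  define h where "h c = c / cosh (c * L)" for c
  have peak: "h c < h m" if "0 < c" "c \<noteq> m" for c using peak[OF that] by (simp add: h_def)
  have hpos: "0 < h c" if "0 < c" for c using that by (simp add: h_def)
  define lstar where "lstar = 2 * (h m)\<^sup>2"
  have lstar: "0 < lstar" using hpos[OF m] by (simp add: lstar_def)
  define C1 C2 where "C1 l = c1 (sqrt (l / 2))" and "C2 l = c2 (sqrt (l / 2))" for l
  have level: "2 * (h c)\<^sup>2 = l \<longleftrightarrow> h c = sqrt (l / 2)" if "0 < c" "0 < l" for c l
  proof -
    have "2 * (h c)\<^sup>2 = l \<longleftrightarrow> (h c)\<^sup>2 = (sqrt (l / 2))\<^sup>2" using that(2) by auto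
    also have "\<dots> \<longleftrightarrow> h c = sqrt (l / 2)"
      using hpos[OF that(1)] that(2) by (subst power2_eq_iff_nonneg) auto
    finally show ?thesis .
  qed
  have below: "2 * (h c)\<^sup>2 < lstar" if "0 < c" "c \<noteq> m" for c
    using peak[OF that] hpos[OF that(1)] by (simp add: lstar_def power_strict_mono)
  have none: "{c. 0 < c \<and> 2 * (h c)\<^sup>2 = l} = {}" if "lstar < l" for l
    using below that by (force simp: lstar_def)
  have one: "{c. 0 < c \<and> 2 * (h c)\<^sup>2 = lstar} = {m}"
    using below m by (force simp: lstar_def)
  have two: "0 < C1 l \<and> C1 l < C2 l \<and> {c. 0 < c \<and> 2 * (h c)\<^sup>2 = l} = {C1 l, C2 l}"
    if l: "0 < l" "l < lstar" for l
  proof -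
    have "sqrt (l / 2) < sqrt ((h m)\<^sup>2)"
      using l(2) by (intro real_sqrt_less_mono) (simp add: lstar_def)
    then have "sqrt (l / 2) < m / cosh (m * L)" using hpos[OF m] by (simp add: h_def)
    with c12[of "sqrt (l / 2)"] l(1)
    have "0 < C1 l \<and> C1 l < C2 l \<and> {c. 0 < c \<and> h c = sqrt (l / 2)} = {C1 l, C2 l}"
      by (simp add: C1_def C2_def h_def)
    moreover have "{c. 0 < c \<and> 2 * (h c)\<^sup>2 = l} = {c. 0 < c \<and> h c = sqrt (l / 2)}"
      using level l(1) by blast
    ultimately show ?thesis by simp
  qed
  have sqrt_lim: "filterlim (\<lambda>l. sqrt (l / 2)) (at_right 0) (at_right 0)"
    unfolding filterlim_at
  proof
    show "((\<lambda>l. sqrt (l / 2)) \<longlongrightarrow> 0) (at_right 0)"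
      by (auto intro!: tendsto_eq_intros)
    show "\<forall>\<^sub>F l::real in at_right 0. sqrt (l / 2) \<in> {0<..} \<and> sqrt (l / 2) \<noteq> 0"
      using eventually_at_right_less[of "0::real"] by (rule eventually_mono) simp
  qed
  have "(C1 \<longlongrightarrow> 0) (at_right 0)" "filterlim C2 at_top (at_right 0)"
    unfolding C1_def [abs_def] C2_def [abs_def]
    using filterlim_compose[OF _ sqrt_lim] lim by blast+
  then show thesis
  proof (rule that[OF lstar, rotated 3])
    show "{c. 0 < c \<and> 2 * (c / cosh (c * L))\<^sup>2 = l} = {}" if "lstar < l" for l
      using none[OF that] by (simp only: h_def)
    show "\<exists>m. {c. 0 < c \<and> 2 * (c / cosh (c * L))\<^sup>2 = lstar} = {m}"
      using one unfolding h_def by blast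
    show "0 < C1 l \<and> C1 l < C2 l \<and> {c. 0 < c \<and> 2 * (c / cosh (c * L))\<^sup>2 = l} = {C1 l, C2 l}"
      if "0 < l" "l < lstar" for l
      using two[OF that] by (simp only: h_def)
  qed
qed

section \<open>Radial solutions on the annulus\<close>

lemma has_real_derivative_along_ray:
  fixes f :: "'a::euclidean_space \<Rightarrow> real"
  assumes "f differentiable (at (exp (k - s) *\<^sub>R e))"
  shows "((\<lambda>s. f (exp (k - s) *\<^sub>R e)) has_real_derivative
           - exp (k - s) * partial_deriv e f (exp (k - s) *\<^sub>R e)) (at s)"
proof -
  let ?F = "frechet_derivative f (at (exp (k - s) *\<^sub>R e))"
  have "((\<lambda>s. exp (k - s) *\<^sub>R e) has_derivative (\<lambda>h. (- exp (k - s) * h) *\<^sub>R e)) (at s)"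
    by (auto intro!: derivative_eq_intros)
  from has_derivative_compose[OF this assms[unfolded frechet_derivative_works]]
  have "((\<lambda>s. f (exp (k - s) *\<^sub>R e)) has_derivative (\<lambda>h. ?F ((- exp (k - s) * h) *\<^sub>R e))) (at s)" .
  moreover have "(\<lambda>h. ?F ((- exp (k - s) * h) *\<^sub>R e))
      = (*) (- exp (k - s) * partial_deriv e f (exp (k - s) *\<^sub>R e))"
    by (rule ext) (simp only: partial_deriv_def real_scaleR_def mult_ac
        linear_scale[OF linear_frechet_derivative[OF assms]])
  ultimately show ?thesis by (simp add: has_field_derivative_def)
qed

lemma open_annulus: "open (annulus a b)"
proof -
  have "annulus a b = ball 0 b - cball 0 a" by (auto simp: annulus_def)
  then show ?thesis by (simp add: open_Diff)
qed

lemma closure_annulus: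
  assumes "0 < a" "a < b"
  shows "closure (annulus a b) = {x. a \<le> norm x \<and> norm x \<le> b}"
proof
  have "{x::real^2. a \<le> norm x \<and> norm x \<le> b} = cball 0 b \<inter> - ball 0 a" by auto
  then have "closed {x::real^2. a \<le> norm x \<and> norm x \<le> b}" by (simp add: closed_Int closed_Compl)
  then show "closure (annulus a b) \<subseteq> {x. a \<le> norm x \<and> norm x \<le> b}"
    by (intro closure_minimal) (auto simp: annulus_def)
  show "{x. a \<le> norm x \<and> norm x \<le> b} \<subseteq> closure (annulus a b)"
  proof clarify
    fix x :: "real^2" assume x: "a \<le> norm x" "norm x \<le> b"
    \<comment> \<open>the radial segment through \<open>x\<close> runs inside the open annulus up to its end points\<close>
    let ?f = "\<lambda>r. (r / norm x) *\<^sub>R x"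
    have "?f ` closure {a<..<b} \<subseteq> closure (annulus a b)"
      using x assms
      by (intro image_closure_subset continuous_intros)
         (auto simp: annulus_def intro!: subsetD[OF closure_subset])
    moreover have "norm x \<in> closure {a<..<b}" using x assms by simp
    ultimately have "?f (norm x) \<in> closure (annulus a b)" by blast
    moreover have "x \<noteq> 0" using x assms by auto
    ultimately show "x \<in> closure (annulus a b)" by (simp split: if_splits)
  qed
qed

definition half_width :: "real \<Rightarrow> real \<Rightarrow> real" where
  "half_width a b = (ln b - ln a) / 2"

text \<open>The logarithmic coordinate, shifted so that the annulus is mapped onto the symmetric interval
  \<open>(- half_width a b, half_width a b)\<close>; its zero is the circle of radius \<open>sqrt (a b)\<close>, and it
  decreases with the radius.\<close>

definition log_polar :: "real \<Rightarrow> real \<Rightarrow> real^2 \<Rightarrow> real" where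
  "log_polar a b x = ln (a * b) / 2 - ln (norm x)"

text \<open>Restricted to the closed annulus, because solutions are compared as extensional functions.\<close>

definition liouville_solution :: "real \<Rightarrow> real \<Rightarrow> real \<Rightarrow> real^2 \<Rightarrow> real" where
  "liouville_solution a b c =
     restrict (\<lambda>x. liouville_profile (half_width a b) c (log_polar a b x)) (closure (annulus a b))"

context
  fixes a b :: real
  assumes a_pos: "0 < a" and a_less_b: "a < b"
begin

lemma half_width_pos: "0 < half_width a b"
  using a_pos a_less_b by (simp add: half_width_def)

lemma log_polar_radius:
  assumes "norm x = exp (ln (a * b) / 2 - s)"
  shows "log_polar a b x = s"
    and "x \<in> annulus a b \<longleftrightarrow> \<bar>s\<bar> < half_width a b"
    and "x \<in> closure (annulus a b) \<longleftrightarrow> \<bar>s\<bar> \<le> half_width a b"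
proof -
  let ?k = "ln (a * b) / 2"
  have b: "0 < b" using a_pos a_less_b by simp
  show "log_polar a b x = s" using assms by (simp add: log_polar_def)
  have k: "ln a = ?k - half_width a b" "ln b = ?k + half_width a b"
    using a_pos b by (simp_all add: half_width_def ln_mult field_simps)
  have "a < norm x \<longleftrightarrow> ln a < ?k - s" "norm x < b \<longleftrightarrow> ?k - s < ln b"
    using a_pos b assms by (metis exp_ln exp_less_cancel_iff)+
  then show "x \<in> annulus a b \<longleftrightarrow> \<bar>s\<bar> < half_width a b"
    unfolding k by (auto simp: annulus_def)
  have "a \<le> norm x \<longleftrightarrow> ln a \<le> ?k - s" "norm x \<le> b \<longleftrightarrow> ?k - s \<le> ln b"
    using a_pos b assms by (metis exp_ln exp_le_cancel_iff)+
  then show "x \<in> closure (annulus a b) \<longleftrightarrow> \<bar>s\<bar> \<le> half_width a b"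
    unfolding k closure_annulus[OF a_pos a_less_b] by auto
qed

lemma norm_eq_exp_log_polar:
  "x \<noteq> 0 \<Longrightarrow> norm x = exp (ln (a * b) / 2 - log_polar a b x)"
  by (simp add: log_polar_def)

lemma annulus_nonzero: "x \<in> annulus a b \<Longrightarrow> x \<noteq> 0" "x \<in> closure (annulus a b) \<Longrightarrow> x \<noteq> 0"
  using a_pos by (force simp: annulus_def, force simp: closure_annulus[OF a_pos a_less_b])

lemma log_polar_bounds:
  "x \<in> annulus a b \<Longrightarrow> \<bar>log_polar a b x\<bar> < half_width a b"
  "x \<in> closure (annulus a b) \<Longrightarrow> \<bar>log_polar a b x\<bar> \<le> half_width a b"
  using log_polar_radius[OF norm_eq_exp_log_polar] annulus_nonzero by blast+

lemma continuous_on_log_polar: "continuous_on (closure (annulus a b)) (log_polar a b)"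
  unfolding log_polar_def [abs_def] using annulus_nonzero(2)
  by (intro continuous_intros) auto

lemma log_polar_frontier:
  "x \<in> frontier (annulus a b) \<Longrightarrow> \<bar>log_polar a b x\<bar> = half_width a b"
  using log_polar_radius(2,3)[OF norm_eq_exp_log_polar, of x] annulus_nonzero(2)[of x]
  unfolding frontier_def interior_open[OF open_annulus] by force

lemma continuous_on_liouville_solution:
  "continuous_on (closure (annulus a b)) (liouville_solution a b c)"
proof -
  have "continuous_on UNIV (liouville_profile (half_width a b) c)"
    by (rule DERIV_continuous_on[OF liouville_profile_deriv])
  then have "continuous_on (closure (annulus a b))
      (\<lambda>x. liouville_profile (half_width a b) c (log_polar a b x))"
    by (rule continuous_on_compose2[OF _ continuous_on_log_polar]) simp
  then show ?thesis by (rule continuous_on_eq) (simp add: liouville_solution_def)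
qed

lemma liouville_solution_in_radial_solutions:
  "liouville_solution a b c \<in> radial_solutions a b (2 * (c / cosh (c * half_width a b))\<^sup>2)"
proof -
  let ?A = "annulus a b" and ?L = "half_width a b" and ?u = "liouville_solution a b c"
  let ?l = "2 * (c / cosh (c * ?L))\<^sup>2" and ?k = "ln (a * b) / 2"
  let ?\<phi> = "liouville_profile ?L c"
  let ?\<phi>'' = "\<lambda>s. - ?l * exp (?\<phi> s)"
  have A: "0 \<notin> ?A" using annulus_nonzero(1) by blast
  have u: "?u x = ?\<phi> (?k - ln (norm x))" if "x \<in> ?A" for x
    using that closure_subset by (auto simp: liouville_solution_def log_polar_def)
  have C2: "C_k_on 2 ?u ?A"
  proof (rule log_polar_C_2[OF open_annulus A u liouville_profile_deriv liouville_profile_deriv2])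
    show "continuous_on ((\<lambda>x. ?k - ln (norm x)) ` ?A) ?\<phi>''"
      by (intro continuous_intros DERIV_continuous_on[OF
            has_field_derivative_at_within[OF liouville_profile_deriv]])
  qed
  have pde: "- laplacian ?u x = ?l * (exp (?u x) / (norm x)\<^sup>2)" if "x \<in> ?A" for x
    by (subst log_polar_laplacian[OF open_annulus A u liouville_profile_deriv
          liouville_profile_deriv2[where L = ?L] that]) (simp_all add: u[OF that])
  have bc: "?u x = 0" if "x \<in> frontier ?A" for x
  proof -
    have "log_polar a b x = ?L \<or> log_polar a b x = - ?L"
      using log_polar_frontier[OF that] by auto
    moreover have "x \<in> closure ?A" using that by (simp add: frontier_def)
    ultimately show ?thesis by (auto simp: liouville_solution_def liouville_profile_def)
  qed
  have "radially_symmetric_on (closure ?A) ?u"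
    by (simp add: radially_symmetric_on_def liouville_solution_def log_polar_def)
  then show ?thesis
    using C2 pde bc continuous_on_liouville_solution
    by (simp add: radial_solutions_def liouville_solution_def)
qed

text \<open>The profile \<open>w s = u (exp (k - s) e)\<close> along a ray inherits two derivatives from \<open>u\<close>, so
  \<open>log_polar_laplacian\<close> applies to \<open>u\<close> itself and turns the equation into the one-dimensional
  one.\<close>

lemma radial_solution_classification:
  assumes "0 < l" and u: "u \<in> radial_solutions a b l"
  shows "\<exists>c>0. l = 2 * (c / cosh (c * half_width a b))\<^sup>2 \<and> u = liouville_solution a b c"
proof -
  let ?A = "annulus a b" and ?L = "half_width a b" and ?k = "ln (a * b) / 2"
  define e :: "real^2" where "e = axis 1 1"
  have e: "norm e = 1" "e \<in> Basis" by (auto simp: e_def norm_axis_1 Basis_vec_def)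
  define \<gamma> where "\<gamma> s = exp (?k - s) *\<^sub>R e" for s
  have \<gamma>: "norm (\<gamma> s) = exp (?k - s)" for s using e by (simp add: \<gamma>_def)
  define w where "w s = u (\<gamma> s)" for s
  define p where "p = partial_deriv e u"
  define w' where "w' s = - exp (?k - s) * p (\<gamma> s)" for s
  define w'' where "w'' s = exp (?k - s) * p (\<gamma> s)
      + (exp (?k - s))\<^sup>2 * partial_deriv e p (\<gamma> s)" for s
  have \<gamma>_A: "\<gamma> s \<in> ?A" if "\<bar>s\<bar> < ?L" for s using log_polar_radius(2)[OF \<gamma>] that by blast
  have diff: "u differentiable (at x)" "p differentiable (at x)" if "x \<in> ?A" for x
    using u that e by (auto simp: radial_solutions_def numeral_2_eq_2 p_def)
  have w: "(w has_real_derivative w' s) (at s)" if "\<bar>s\<bar> < ?L" for s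
    using has_real_derivative_along_ray[of u ?k _ e, folded \<gamma>_def, OF diff(1)[OF \<gamma>_A[OF that]]]
    by (simp add: w_def [abs_def] w'_def p_def)
  have w': "(w' has_real_derivative w'' s) (at s)" if "\<bar>s\<bar> < ?L" for s
    unfolding w'_def [abs_def]
    using has_real_derivative_along_ray[of p ?k _ e, folded \<gamma>_def, OF diff(2)[OF \<gamma>_A[OF that]]]
    by (auto intro!: derivative_eq_intros simp: w''_def power2_eq_square)
  have u_w: "u x = w (?k - ln (norm x))" if "x \<in> closure ?A" for x
  proof -
    have "norm (\<gamma> (?k - ln (norm x))) = norm x"
      using annulus_nonzero(2)[OF that] by (simp add: \<gamma>)
    moreover from this have "\<gamma> (?k - ln (norm x)) \<in> closure ?A"
      using that by (simp add: closure_annulus[OF a_pos a_less_b])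
    moreover have "radially_symmetric_on (closure ?A) u" using u by (simp add: radial_solutions_def)
    ultimately show ?thesis using that unfolding radially_symmetric_on_def w_def by metis
  qed
  have ode: "w'' s = - l * exp (w s)" if s: "\<bar>s\<bar> < ?L" for s
  proof -
    have bound: "\<bar>?k - ln (norm x)\<bar> < ?L" if "x \<in> ?A" for x
      using log_polar_bounds(1)[OF that] by (simp add: log_polar_def)
    have "u x = w (?k - ln (norm x))" if "x \<in> ?A" for x
      using u_w that closure_subset by blast
    moreover have "0 \<notin> ?A" using annulus_nonzero(1) by blast
    ultimately have "laplacian u (\<gamma> s) = (w'' (?k - ln (norm (\<gamma> s)))
        - (real DIM(real^2) - 2) * w' (?k - ln (norm (\<gamma> s)))) / (norm (\<gamma> s))\<^sup>2"
      by (intro log_polar_laplacian[where u = u and \<phi> = w and \<phi>' = w' and \<phi>'' = w'' and k = ?k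
            and S = ?A] open_annulus w w' bound \<gamma>_A s)
    then have "laplacian u (\<gamma> s) = w'' s / (norm (\<gamma> s))\<^sup>2"
      by (simp add: \<gamma>)
    moreover have "- laplacian u (\<gamma> s) = l * (exp (w s) / (norm (\<gamma> s))\<^sup>2)"
      using u \<gamma>_A[OF s] by (simp add: radial_solutions_def w_def)
    ultimately show ?thesis by (simp add: \<gamma> field_simps)
  qed
  have "continuous_on {-?L..?L} w"
    unfolding w_def
  proof (rule continuous_on_compose2[where g = u and t = "closure ?A"])
    show "continuous_on {-?L..?L} \<gamma>" unfolding \<gamma>_def by (intro continuous_intros)
    show "continuous_on (closure ?A) u" using u by (simp add: radial_solutions_def)
    show "\<gamma> ` {-?L..?L} \<subseteq> closure ?A"
    proof (rule image_subsetI)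
      fix s assume "s \<in> {-?L..?L}"
      then have "\<bar>s\<bar> \<le> ?L" by (simp add: abs_le_iff)
      then show "\<gamma> s \<in> closure ?A" using log_polar_radius(3)[OF \<gamma>] by blast
    qed
  qed
  moreover have "w s = 0" if "\<bar>s\<bar> = ?L" for s
  proof -
    have "\<gamma> s \<in> frontier ?A"
      using log_polar_radius(2,3)[OF \<gamma>, of s] that
      by (simp add: frontier_def interior_open[OF open_annulus])
    then show ?thesis using u by (simp add: radial_solutions_def w_def)
  qed
  ultimately have "\<exists>c>0. l = 2 * (c / cosh (c * ?L))\<^sup>2 \<and> (\<forall>s\<in>{-?L..?L}. w s = liouville_profile ?L c s)"
    using half_width_pos ode w w'
    by (intro liouville_dirichlet_classification[where w' = w'] \<open>0 < l\<close>) (simp_all add: abs_less_iff)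
  then obtain c where c: "c > 0" "l = 2 * (c / cosh (c * ?L))\<^sup>2"
      "\<And>s. s \<in> {-?L..?L} \<Longrightarrow> w s = liouville_profile ?L c s"
    by blast
  have "u = liouville_solution a b c"
  proof (rule extensionalityI[where A = "closure ?A"])
    fix x assume x: "x \<in> closure ?A"
    then have "?k - ln (norm x) \<in> {-?L..?L}"
      using log_polar_bounds(2)[OF x] by (simp add: log_polar_def abs_le_iff)
    from c(3)[OF this] u_w[OF x] x show "u x = liouville_solution a b c x"
      by (simp add: liouville_solution_def log_polar_def)
  qed (use u in \<open>auto simp: radial_solutions_def liouville_solution_def\<close>)
  with c show ?thesis by blast
qed

end

section \<open>Size, mass and shape of the solutions\<close>

lemma liouville_profile_bounds:
  assumes "0 \<le> c" "\<bar>s\<bar> \<le> L"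
  shows "0 \<le> liouville_profile L c s" "liouville_profile L c s \<le> 2 * ln (cosh (c * L))"
proof -
  have "\<bar>c * s\<bar> \<le> c * L" using assms by (simp add: abs_mult mult_left_mono)
  then have "cosh \<bar>c * s\<bar> \<le> cosh (c * L)" by (subst cosh_real_nonneg_le_iff) auto
  then show "0 \<le> liouville_profile L c s" by (simp add: liouville_profile_def)
  show "liouville_profile L c s \<le> 2 * ln (cosh (c * L))"
    by (simp add: liouville_profile_def cosh_real_ge_1)
qed

text \<open>The derivative in the parameter is \<open>2 (L tanh (c L) - s tanh (c s))\<close>, and \<open>s tanh (c s)\<close>
  grows with \<open>|s|\<close>.\<close>

lemma liouville_profile_mono:
  assumes "0 \<le> c" "c \<le> d" "\<bar>s\<bar> \<le> L"
  shows "liouville_profile L c s \<le> liouville_profile L d s"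
proof (rule DERIV_nonneg_imp_nondecreasing[OF assms(2)])
  fix x assume x: "c \<le> x" "x \<le> d"
  have "s * tanh (x * s) = \<bar>s\<bar> * tanh (x * \<bar>s\<bar>)" by (cases "0 \<le> s") auto
  also have "\<dots> \<le> L * tanh (x * L)"
    using assms x by (intro mult_mono) (auto intro: mult_left_mono)
  finally have "0 \<le> 2 * (L * tanh (x * L)) - 2 * (s * tanh (x * s))" by simp
  moreover have "((\<lambda>x. liouville_profile L x s) has_real_derivative
      2 * (L * tanh (x * L)) - 2 * (s * tanh (x * s))) (at x)"
    unfolding liouville_profile_def
    by (auto intro!: derivative_eq_intros simp: tanh_def mult_ac)
  ultimately show "\<exists>y. ((\<lambda>x. liouville_profile L x s) has_real_derivative y) (at x) \<and> 0 \<le> y"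
    by blast
qed

text \<open>Since \<open>ln (cosh x)\<close> differs from \<open>|x|\<close> by at most \<open>ln 2\<close>, the profile divided by \<open>c\<close> is a
  tent of height \<open>2 L\<close> up to an error of order \<open>1 / c\<close>, uniformly in \<open>s\<close>.\<close>

lemma liouville_profile_tent:
  assumes "0 < c"
  shows "\<bar>liouville_profile L c s / c - 2 * (\<bar>L\<bar> - \<bar>s\<bar>)\<bar> \<le> 2 * ln 2 / c"
proof -
  have ln_cosh: "\<bar>x\<bar> - ln 2 \<le> ln (cosh x)" "ln (cosh x) \<le> \<bar>x\<bar>" for x :: real
  proof -
    have "exp \<bar>x\<bar> / 2 \<le> cosh \<bar>x\<bar>" by (simp add: cosh_def)
    then have "ln (exp \<bar>x\<bar> / 2) \<le> ln (cosh \<bar>x\<bar>)" by (subst ln_le_cancel_iff) auto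
    then show "\<bar>x\<bar> - ln 2 \<le> ln (cosh x)" by (simp add: ln_div)
    have "cosh \<bar>x\<bar> \<le> exp \<bar>x\<bar>" by (simp add: cosh_def)
    then have "ln (cosh \<bar>x\<bar>) \<le> ln (exp \<bar>x\<bar>)" by (subst ln_le_cancel_iff) auto
    then show "ln (cosh x) \<le> \<bar>x\<bar>" by simp
  qed
  have "\<bar>liouville_profile L c s - 2 * (\<bar>c * L\<bar> - \<bar>c * s\<bar>)\<bar> \<le> 2 * ln 2"
    using ln_cosh[of "c * L"] ln_cosh[of "c * s"] by (simp add: liouville_profile_def)
  moreover have "liouville_profile L c s / c - 2 * (\<bar>L\<bar> - \<bar>s\<bar>)
      = (liouville_profile L c s - 2 * (\<bar>c * L\<bar> - \<bar>c * s\<bar>)) / c"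
    using assms by (simp add: abs_mult field_simps)
  ultimately show ?thesis using assms by (simp add: abs_divide divide_right_mono)
qed

text \<open>A continuous function on an open set exceeds every number below its maximum on a nonempty open
  set, which is not negligible; so the essential supremum is the maximum.\<close>

lemma Linf_norm_on_eq_max:
  fixes f :: "'a::euclidean_space \<Rightarrow> real"
  assumes S: "open S" "continuous_on S f" and x0: "x0 \<in> S"
    and max: "\<And>x. x \<in> S \<Longrightarrow> \<bar>f x\<bar> \<le> \<bar>f x0\<bar>"
  shows "Linf_norm_on S f = \<bar>f x0\<bar>"
proof -
  let ?M = "lebesgue_on S" and ?g = "\<lambda>x. ereal \<bar>f x\<bar>"
  have S_sets: "S \<in> sets lebesgue" using S(1) by simp
  have cont: "continuous_on S ?g" using S(2) by (intro continuous_intros)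
  have "esssup ?M ?g \<le> ereal \<bar>f x0\<bar>"
    using max
    by (intro esssup_I AE_I2 continuous_imp_measurable_on_sets_lebesgue cont S_sets) auto
  moreover have "\<not> esssup ?M ?g < ereal \<bar>f x0\<bar>"
  proof
    assume less: "esssup ?M ?g < ereal \<bar>f x0\<bar>"
    let ?T = "S \<inter> ?g -` {esssup ?M ?g<..}"
    have "open ?T" using cont S(1) by (intro continuous_open_preimage) auto
    moreover have "x0 \<in> ?T" using x0 less by simp
    ultimately have "\<not> negligible ?T" using open_not_negligible by blast
    moreover have "?T = {x \<in> space ?M. ?g x > esssup ?M ?g}" by auto
    then have "emeasure ?M ?T = 0" using esssup_zero_measure[of ?M ?g] by simp
    then have "emeasure lebesgue ?T = 0"
      using S_sets by (subst (asm) emeasure_restrict_space) auto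
    then have "negligible ?T"
      using \<open>open ?T\<close> by (auto simp: negligible_iff_null_sets intro!: null_setsI)
    ultimately show False by blast
  qed
  ultimately have "esssup ?M ?g = ereal \<bar>f x0\<bar>" by simp
  then show ?thesis by (simp add: Linf_norm_on_def)
qed

lemma measure_annulus:
  assumes "0 \<le> r" "r \<le> R"
  shows "annulus r R \<in> lmeasurable" "measure lebesgue (annulus r R) = pi * (R\<^sup>2 - r\<^sup>2)"
proof -
  have eq: "annulus r R = ball 0 R - cball 0 r" by (auto simp: annulus_def)
  show "annulus r R \<in> lmeasurable" unfolding eq by (intro fmeasurable.Diff) auto
  show "measure lebesgue (annulus r R) = pi * (R\<^sup>2 - r\<^sup>2)"
  proof (cases "r = R")
    case True
    then have "annulus r R = {}" by (auto simp: annulus_def)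
    with True show ?thesis by simp
  next
    case False
    then have "measure lebesgue (annulus r R) = measure lebesgue (ball (0::real^2) R)
        - measure lebesgue (cball (0::real^2) r)"
      unfolding eq using assms by (intro measurable_measure_Diff) auto
    also have "measure lebesgue (cball (0::real^2) r) = measure lebesgue (ball (0::real^2) r)"
      using assms by (simp add: content_cball content_ball)
    finally show ?thesis using assms by (simp add: circle_area algebra_simps)
  qed
qed

context
  fixes a b :: real
  assumes a_pos: "0 < a" and a_less_b: "a < b"
begin

lemma liouville_solution_eq:
  "x \<in> closure (annulus a b) \<Longrightarrow>
    liouville_solution a b c x = liouville_profile (half_width a b) c (log_polar a b x)"
  by (simp add: liouville_solution_def)

lemma liouville_solution_on_axis:
  assumes "\<bar>s\<bar> \<le> half_width a b"
  shows "radial_profile (liouville_solution a b c) (exp (ln (a * b) / 2 - s))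
    = liouville_profile (half_width a b) c s"
  using log_polar_radius(1,3)[OF a_pos a_less_b, of "exp (ln (a * b) / 2 - s) *\<^sub>R axis 1 1" s] assms
  by (simp add: radial_profile_def liouville_solution_def)

lemma Linf_norm_liouville_solution:
  assumes "0 \<le> c"
  shows "Linf_norm_on (annulus a b) (liouville_solution a b c) = 2 * ln (cosh (c * half_width a b))"
proof -
  let ?A = "annulus a b" and ?u = "liouville_solution a b c" and ?L = "half_width a b"
  let ?M = "2 * ln (cosh (c * ?L))"
  define x0 :: "real^2" where "x0 = exp (ln (a * b) / 2 - 0) *\<^sub>R axis 1 1"
  have "norm x0 = exp (ln (a * b) / 2 - 0)" by (simp add: x0_def)
  from log_polar_radius[OF a_pos a_less_b this] half_width_pos[OF a_pos a_less_b]
  have x0: "x0 \<in> ?A" "x0 \<in> closure ?A" "log_polar a b x0 = 0" by auto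
  then have u0: "?u x0 = ?M" by (simp add: liouville_solution_eq liouville_profile_def)
  have "0 \<le> ?M" by (simp add: cosh_real_ge_1)
  have bounds: "\<bar>?u x\<bar> \<le> \<bar>?u x0\<bar>" if "x \<in> ?A" for x
  proof -
    have x: "x \<in> closure ?A" using that closure_subset by blast
    from liouville_profile_bounds[OF assms log_polar_bounds(2)[OF a_pos a_less_b x]]
    show ?thesis unfolding u0 liouville_solution_eq[OF x] by linarith
  qed
  have "continuous_on ?A ?u"
    by (rule continuous_on_subset[OF continuous_on_liouville_solution[OF a_pos a_less_b]])
       (rule closure_subset)
  from Linf_norm_on_eq_max[OF open_annulus this x0(1) bounds] u0 \<open>0 \<le> ?M\<close>
  show ?thesis by simp
qed

lemma liouville_solution_mass_integrable:
  assumes "0 \<le> c"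
  shows "integrable (lebesgue_on (annulus a b)) (\<lambda>x. exp (liouville_solution a b c x) / (norm x)\<^sup>2)"
    and "\<And>x. x \<in> annulus a b \<Longrightarrow> exp (liouville_solution a b c x) / (norm x)\<^sup>2
           \<le> (cosh (c * half_width a b))\<^sup>2 / a\<^sup>2"
proof -
  let ?A = "annulus a b" and ?u = "liouville_solution a b c" and ?L = "half_width a b"
  let ?B = "(cosh (c * ?L))\<^sup>2 / a\<^sup>2"
  show bound: "exp (?u x) / (norm x)\<^sup>2 \<le> ?B" if "x \<in> ?A" for x
  proof -
    have x: "x \<in> closure ?A" using that closure_subset by blast
    have "?u x \<le> 2 * ln (cosh (c * ?L))"
      unfolding liouville_solution_eq[OF x]
      by (rule liouville_profile_bounds(2)[OF assms log_polar_bounds(2)[OF a_pos a_less_b x]])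
    then have "exp (?u x) \<le> exp (2 * ln (cosh (c * ?L)))" by simp
    also have "\<dots> = (cosh (c * ?L))\<^sup>2" by (simp add: exp_double)
    finally show ?thesis
      using that a_pos by (intro frac_le power_mono) (auto simp: annulus_def)
  qed
  have "continuous_on ?A ?u"
    by (rule continuous_on_subset[OF continuous_on_liouville_solution[OF a_pos a_less_b]])
       (rule closure_subset)
  then have "continuous_on ?A (\<lambda>x. exp (?u x) / (norm x)\<^sup>2)"
    using annulus_nonzero(1)[OF a_pos a_less_b] by (intro continuous_intros) auto
  then have "(\<lambda>x. exp (?u x) / (norm x)\<^sup>2) \<in> borel_measurable (lebesgue_on ?A)"
    using open_annulus by (intro continuous_imp_measurable_on_sets_lebesgue) auto
  moreover have "AE x in lebesgue_on ?A. norm (exp (?u x) / (norm x)\<^sup>2) \<le> ?B"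
    using bound by (intro AE_I2) auto
  ultimately show "integrable (lebesgue_on ?A) (\<lambda>x. exp (?u x) / (norm x)\<^sup>2)"
    using a_pos a_less_b
    by (intro finite_measure.integrable_const_bound[where B = ?B] finite_measure_lebesgue_on
        measure_annulus(1)) auto
qed

lemma liouville_solution_mass_upper:
  assumes "0 \<le> c"
  shows "2 * (c / cosh (c * half_width a b))\<^sup>2 *
      (\<integral>x. exp (liouville_solution a b c x) / (norm x)\<^sup>2 \<partial>lebesgue_on (annulus a b))
    \<le> 2 * c\<^sup>2 * (pi * (b\<^sup>2 - a\<^sup>2) / a\<^sup>2)"
proof -
  let ?A = "annulus a b" and ?u = "liouville_solution a b c" and ?L = "half_width a b"
  let ?B = "(cosh (c * ?L))\<^sup>2 / a\<^sup>2"
  have A: "?A \<in> lmeasurable" "measure lebesgue ?A = pi * (b\<^sup>2 - a\<^sup>2)"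
    using measure_annulus a_pos a_less_b by auto
  interpret finite_measure "lebesgue_on ?A" by (rule finite_measure_lebesgue_on[OF A(1)])
  have "(\<integral>x. exp (?u x) / (norm x)\<^sup>2 \<partial>lebesgue_on ?A) \<le> (\<integral>x. ?B \<partial>lebesgue_on ?A)"
    using liouville_solution_mass_integrable[OF assms] by (intro integral_mono) auto
  also have "\<dots> = ?B * (pi * (b\<^sup>2 - a\<^sup>2))"
    using A by (simp add: measure_restrict_space fmeasurableD)
  finally have "2 * (c / cosh (c * ?L))\<^sup>2 * (\<integral>x. exp (?u x) / (norm x)\<^sup>2 \<partial>lebesgue_on ?A)
      \<le> 2 * (c / cosh (c * ?L))\<^sup>2 * (?B * (pi * (b\<^sup>2 - a\<^sup>2)))"
    by (intro mult_left_mono) auto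
  also have "\<dots> = 2 * c\<^sup>2 * (pi * (b\<^sup>2 - a\<^sup>2) / a\<^sup>2)"
    by (simp add: power_divide)
  finally show ?thesis .
qed

text \<open>Where the coordinate \<open>s\<close> satisfies \<open>|c s| < 1\<close>, the integrand with its factor is at least
  \<open>2 c\<^sup>2 / (b cosh 1)\<^sup>2\<close>, and this part of the annulus has area
  \<open>\<pi> a b (exp (2 / c) - exp (- 2 / c)) \<ge> 2 \<pi> a b / c\<close>.  The product grows like \<open>c\<close>.\<close>

lemma liouville_solution_mass_lower:
  assumes c: "0 < c" "1 / c \<le> half_width a b"
  shows "4 * pi * a / (b * (cosh 1)\<^sup>2) * c \<le> 2 * (c / cosh (c * half_width a b))\<^sup>2 *
      (\<integral>x. exp (liouville_solution a b c x) / (norm x)\<^sup>2 \<partial>lebesgue_on (annulus a b))"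
proof -
  let ?A = "annulus a b" and ?u = "liouville_solution a b c" and ?L = "half_width a b"
  let ?k = "ln (a * b) / 2"
  define r R where "r = exp (?k - 1 / c)" and "R = exp (?k + 1 / c)"
  define B where "B = annulus r R"
  have r: "0 \<le> r" "r \<le> R" using c by (auto simp: r_def R_def)
  have b: "0 < b" using a_pos a_less_b by simp
  define K where "K = (cosh (c * ?L) / cosh 1)\<^sup>2 / b\<^sup>2"
  have "0 \<le> K" by (simp add: K_def)
  have near: "\<bar>log_polar a b x\<bar> < 1 / c" if "x \<in> B" for x
  proof -
    have "0 < r" "r < norm x" "norm x < R"
      using that by (simp_all add: r_def B_def annulus_def)
    moreover from this have "0 < norm x" "0 < R" by linarith+
    ultimately have "ln r < ln (norm x)" "ln (norm x) < ln R" by simp_all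
    then show ?thesis by (simp add: log_polar_def abs_less_iff r_def R_def)
  qed
  have "B \<subseteq> ?A"
  proof
    fix x assume "x \<in> B"
    then have "x \<noteq> 0" using r by (auto simp: B_def annulus_def)
    from log_polar_radius(2)[OF a_pos a_less_b norm_eq_exp_log_polar[OF a_pos a_less_b this]]
    show "x \<in> ?A" using near[OF \<open>x \<in> B\<close>] c(2) by simp
  qed
  have B: "B \<in> lmeasurable" "measure lebesgue B = pi * (R\<^sup>2 - r\<^sup>2)"
    using measure_annulus[OF r] by (auto simp: B_def)
  have A: "?A \<in> lmeasurable" using measure_annulus(1) a_pos a_less_b by auto
  interpret finite_measure "lebesgue_on ?A" by (rule finite_measure_lebesgue_on[OF A])
  have B_sets: "B \<in> sets (lebesgue_on ?A)"
    using B(1) A \<open>B \<subseteq> ?A\<close> by (subst sets_restrict_space_iff) (auto simp: fmeasurableD)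
  have lower: "indicator B x * K \<le> exp (?u x) / (norm x)\<^sup>2" if x: "x \<in> ?A" for x
  proof (cases "x \<in> B")
    case True
    let ?s = "log_polar a b x"
    have "\<bar>c * ?s\<bar> \<le> 1" using near[OF True] c(1) by (simp add: abs_mult field_simps)
    then have "cosh \<bar>c * ?s\<bar> \<le> cosh 1" by (subst cosh_real_nonneg_le_iff) auto
    then have "(cosh (c * ?L) / cosh 1)\<^sup>2 \<le> (cosh (c * ?L) / cosh (c * ?s))\<^sup>2"
      by (intro power_mono divide_left_mono) auto
    also have "\<dots> = exp (?u x)"
      using subsetD[OF closure_subset x]
      by (simp add: liouville_solution_eq liouville_profile_def exp_diff exp_double power_divide)
    finally have "K \<le> exp (?u x) / (norm x)\<^sup>2"
      unfolding K_def using x a_pos by (intro frac_le power_mono) (auto simp: annulus_def)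
    then show ?thesis using True by simp
  qed simp
  have "K * (pi * (R\<^sup>2 - r\<^sup>2)) = (\<integral>x. indicator B x * K \<partial>lebesgue_on ?A)"
    using B_sets B \<open>B \<subseteq> ?A\<close> A
    by (simp add: measure_restrict_space fmeasurableD Int_absorb2)
  also have "\<dots> \<le> (\<integral>x. exp (?u x) / (norm x)\<^sup>2 \<partial>lebesgue_on ?A)"
    using lower liouville_solution_mass_integrable(1)[of c] c(1) B_sets
    by (intro integral_mono integrable_mult_left integrable_real_indicator) (auto simp: emeasure_eq_measure)
  finally have mass: "2 * (c / cosh (c * ?L))\<^sup>2 * (K * (pi * (R\<^sup>2 - r\<^sup>2)))
      \<le> 2 * (c / cosh (c * ?L))\<^sup>2 * (\<integral>x. exp (?u x) / (norm x)\<^sup>2 \<partial>lebesgue_on ?A)"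
    by (intro mult_left_mono) auto
  have "2 * a * b / c \<le> R\<^sup>2 - r\<^sup>2"
  proof -
    have ab: "exp (2 * ?k) = a * b" using a_pos b by simp
    have "R\<^sup>2 = exp (2 * (?k + 1 / c))" "r\<^sup>2 = exp (2 * (?k - 1 / c))"
      by (simp_all only: R_def r_def exp_double)
    moreover have "2 * (?k + 1 / c) = 2 * ?k + 2 / c" "2 * (?k - 1 / c) = 2 * ?k + - (2 / c)"
      by (simp_all add: algebra_simps)
    ultimately have R2: "R\<^sup>2 = a * b * exp (2 / c)" and r2: "r\<^sup>2 = a * b * exp (- (2 / c))"
      by (simp_all only: exp_add ab)
    have "2 / c \<le> exp (2 / c) - exp (- (2 / c))"
      using exp_ge_add_one_self[of "2 / c"] c(1) by (smt (verit) exp_le_one_iff divide_pos_pos)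
    then have "a * b * (2 / c) \<le> a * b * (exp (2 / c) - exp (- (2 / c)))"
      using a_pos b by (intro mult_left_mono) auto
    then show ?thesis unfolding R2 r2 by (simp add: algebra_simps)
  qed
  then have "2 * (c / cosh (c * ?L))\<^sup>2 * (K * (pi * (2 * a * b / c)))
      \<le> 2 * (c / cosh (c * ?L))\<^sup>2 * (K * (pi * (R\<^sup>2 - r\<^sup>2)))"
    using \<open>0 \<le> K\<close> by (intro mult_left_mono) auto
  moreover have "2 * (c / cosh (c * ?L))\<^sup>2 * (K * (pi * (2 * a * b / c)))
      = 4 * pi * a / (b * (cosh 1)\<^sup>2) * c"
    using c(1) b by (simp add: K_def power_divide power2_eq_square mult_ac)
  ultimately show ?thesis using mass by linarith
qed

end

section \<open>The profile of the large solution\<close>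

text \<open>If \<open>f l\<close> agrees with \<open>g\<close> on the rescaled interval and the scale tends to 0, every compact set
  eventually lies in that open interval, where both the functions and their derivatives coincide.\<close>

lemma converges_C1_loc_rescaled:
  assumes ab: "0 < a" "a < b"
    and \<delta>: "(\<delta> \<longlongrightarrow> 0) F" "\<forall>\<^sub>F l in F. 0 < \<delta> l"
    and eq: "\<forall>\<^sub>F l in F. \<forall>t\<in>rescaled_interval a b (\<delta> l). f l t = g t"
    and g: "\<And>t. g differentiable (at t)"
  shows "converges_C1_loc f (\<lambda>l. rescaled_interval a b (\<delta> l)) g F"
  unfolding converges_C1_loc_def
proof (intro allI impI)
  fix K :: "real set" assume "compact K"
  then obtain R where R: "0 < R" "\<And>t. t \<in> K \<Longrightarrow> \<bar>t\<bar> \<le> R"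
    using compact_imp_bounded bounded_pos by (metis real_norm_def)
  have "0 < (ln b - ln a) / (2 * R)" using ab R(1) by simp
  then have "\<forall>\<^sub>F l in F. \<delta> l < (ln b - ln a) / (2 * R)"
    by (rule order_tendstoD(2)[OF \<delta>(1)])
  with \<delta>(2) have sub: "\<forall>\<^sub>F l in F. K \<subseteq> rescaled_interval a b (\<delta> l)"
  proof eventually_elim
    case (elim l)
    then have "R < (ln b - ln a) / (2 * \<delta> l)" using R(1) by (simp add: field_simps)
    then show ?case using R(2) by (fastforce simp: rescaled_interval_def abs_le_iff)
  qed
  have "\<forall>\<^sub>F l in F. \<forall>t\<in>K. f l t = g t \<and> (f l has_real_derivative deriv g t) (at t)"
    using sub eq
  proof eventually_elim
    case (elim l)
    show ?case
    proof
      fix t assume "t \<in> K"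
      have "(g has_real_derivative deriv g t) (at t)"
        using g[of t] by (simp add: DERIV_deriv_iff_real_differentiable)
      then have "(f l has_real_derivative deriv g t) (at t)"
      proof (rule has_field_derivative_transform_within_open)
        show "open (rescaled_interval a b (\<delta> l))" by (simp add: rescaled_interval_def)
        show "t \<in> rescaled_interval a b (\<delta> l)" using elim(1) \<open>t \<in> K\<close> by blast
        show "g s = f l s" if "s \<in> rescaled_interval a b (\<delta> l)" for s
          using elim(2) that by simp
      qed
      moreover have "f l t = g t" using elim \<open>t \<in> K\<close> by blast
      ultimately show "f l t = g t \<and> (f l has_real_derivative deriv g t) (at t)" by blast
    qed
  qed
  then have ev: "\<forall>\<^sub>F l in F. \<forall>t\<in>K. f l t = g t \<and> f l differentiable (at t) \<and> deriv (f l) t = deriv g t"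
    by (rule eventually_mono) (meson real_differentiable_def DERIV_imp_deriv)
  have "\<forall>\<^sub>F l in F. K \<subseteq> rescaled_interval a b (\<delta> l) \<and> (\<forall>t\<in>K. f l differentiable (at t))"
    using sub ev by eventually_elim blast
  moreover have "uniform_limit K f g F"
    by (rule uniform_limitI) (rule eventually_mono[OF ev], simp)
  moreover have "uniform_limit K (\<lambda>l. deriv (f l)) (deriv g) F"
    by (rule uniform_limitI) (rule eventually_mono[OF ev], simp)
  ultimately show "(\<forall>\<^sub>F l in F. K \<subseteq> rescaled_interval a b (\<delta> l) \<and> (\<forall>t\<in>K. f l differentiable (at t))) \<and>
      uniform_limit K f g F \<and> uniform_limit K (\<lambda>l. deriv (f l)) (deriv g) F"
    by blast
qed

text \<open>The limit profile is the Liouville profile with parameter \<open>c = 1 / sqrt 2\<close>, shifted to have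
  maximum 0.\<close>

lemma bubble_eq_ln_cosh:
  "ln (4 * exp (sqrt 2 * t) / (1 + exp (sqrt 2 * t))\<^sup>2) = - 2 * ln (cosh (t / sqrt 2))"
proof -
  define e where "e = exp (t / sqrt 2)"
  have "0 < e" by (simp add: e_def)
  have "sqrt 2 * t = 2 * (t / sqrt 2)" by (simp add: field_simps)
  then have "exp (sqrt 2 * t) = e\<^sup>2" by (simp only: e_def exp_double)
  moreover have "1 + e\<^sup>2 = 2 * e * cosh (t / sqrt 2)"
    using \<open>0 < e\<close>
    by (simp add: cosh_def exp_minus power2_eq_square field_simps flip: e_def)
  ultimately have "4 * exp (sqrt 2 * t) / (1 + exp (sqrt 2 * t))\<^sup>2
      = 4 * e\<^sup>2 / (2 * e * cosh (t / sqrt 2))\<^sup>2"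
    by (simp only:)
  also have "\<dots> = 1 / (cosh (t / sqrt 2))\<^sup>2"
    using \<open>0 < e\<close> by (simp add: power_mult_distrib)
  finally show ?thesis by (simp add: ln_div ln_realpow)
qed

context
  fixes a b :: real
  assumes a_pos: "0 < a" and a_less_b: "a < b"
begin

text \<open>Subtracting the maximum removes the only term that depends on \<open>L\<close>, and the scale
  \<open>1 / (sqrt 2 c)\<close> normalises the parameter; there is no error term.\<close>

lemma rescaled_liouville_solution:
  assumes "0 < c" and t: "t \<in> rescaled_interval a b (1 / (sqrt 2 * c))"
  shows "rescaled a b (liouville_solution a b c) (1 / (sqrt 2 * c)) t
    = ln (4 * exp (sqrt 2 * t) / (1 + exp (sqrt 2 * t))\<^sup>2)"
proof -
  let ?d = "1 / (sqrt 2 * c)"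
  have "\<bar>t\<bar> < half_width a b / ?d"
  proof -
    have "half_width a b / ?d = (ln b - ln a) / (2 * ?d)" by (simp add: half_width_def)
    then show ?thesis
      using t unfolding rescaled_interval_def greaterThanLessThan_iff abs_less_iff by linarith
  qed
  then have "\<bar>?d * t\<bar> \<le> half_width a b" using assms(1) by (simp add: abs_mult field_simps)
  from liouville_solution_on_axis[OF a_pos a_less_b this, of c]
  have axis: "radial_profile (liouville_solution a b c) (exp (- (?d * t - ln (a * b) / 2)))
      = 2 * ln (cosh (c * half_width a b)) - 2 * ln (cosh (c * (?d * t)))"
    by (simp add: liouville_profile_def)
  have ct: "c * (?d * t) = t / sqrt 2" using assms(1) by simp
  show ?thesis
    unfolding rescaled_def axis ct bubble_eq_ln_cosh
      Linf_norm_liouville_solution[OF a_pos a_less_b less_imp_le[OF assms(1)]]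
    by simp
qed

text \<open>With its pole at the midpoint of an interval of length \<open>2 L\<close>, Green's function is
  \<open>(L - |s|) / 2\<close> in the centred coordinate.\<close>

lemma green_midpoint:
  "2 * sqrt 2 * green (- ln b) (- ln a) (- ln (norm x)) (- ln (sqrt (a * b)))
    = sqrt 2 * (half_width a b - \<bar>log_polar a b x\<bar>)"
proof -
  define L where "L = half_width a b"
  define k where "k = ln (a * b) / 2"
  define s where "s = log_polar a b x"
  have L: "0 < L" unfolding L_def by (rule half_width_pos[OF a_pos a_less_b])
  have b: "0 < b" using a_pos a_less_b by simp
  have eqs: "ln a = k - L" "ln b = k + L" "ln (sqrt (a * b)) = k" "ln (norm x) = k - s"
    using a_pos b by (simp_all add: k_def L_def s_def half_width_def log_polar_def ln_mult ln_sqrt field_simps)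
  have "green (- (k + L)) (- (k - L)) (- (k - s)) (- k) = (L - \<bar>s\<bar>) / 2"
    using L by (auto simp: green_def field_simps)
  then show ?thesis by (simp add: eqs flip: L_def s_def)
qed

lemma liouville_solution_green_distance:
  assumes "0 < c" "x \<in> closure (annulus a b)"
  shows "\<bar>1 / (sqrt 2 * c) * liouville_solution a b c x
      - 2 * sqrt 2 * green (- ln b) (- ln a) (- ln (norm x)) (- ln (sqrt (a * b)))\<bar>
    \<le> 2 * ln 2 / (sqrt 2 * c)"
proof -
  let ?L = "half_width a b" and ?s = "log_polar a b x"
  have "1 / (sqrt 2 * c) * liouville_solution a b c x - sqrt 2 * (?L - \<bar>?s\<bar>)
      = (liouville_profile ?L c ?s / c - 2 * (\<bar>?L\<bar> - \<bar>?s\<bar>)) / sqrt 2" (is "_ = ?T / _")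
    using assms half_width_pos[OF a_pos a_less_b]
    by (simp add: liouville_solution_eq[OF a_pos a_less_b] field_simps)
  moreover have "\<bar>?T / sqrt 2\<bar> \<le> (2 * ln 2 / c) / sqrt 2"
    unfolding abs_divide by (intro frac_le liouville_profile_tent[OF assms(1)]) (use assms(1) in auto)
  moreover have "(2 * ln 2 / c) / sqrt 2 = 2 * ln 2 / (sqrt 2 * c)" by simp
  ultimately show ?thesis unfolding green_midpoint by (simp only:)
qed

end

section \<open>The solution set and its limits\<close>

lemma radial_solutions_eq:
  assumes "0 < a" "a < b" "0 < l"
  shows "radial_solutions a b l
    = liouville_solution a b ` {c. 0 < c \<and> 2 * (c / cosh (c * half_width a b))\<^sup>2 = l}"
proof (rule set_eqI, rule iffI)
  fix u assume "u \<in> radial_solutions a b l"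
  from radial_solution_classification[OF assms this]
  show "u \<in> liouville_solution a b ` {c. 0 < c \<and> 2 * (c / cosh (c * half_width a b))\<^sup>2 = l}"
    by auto
next
  fix u assume "u \<in> liouville_solution a b ` {c. 0 < c \<and> 2 * (c / cosh (c * half_width a b))\<^sup>2 = l}"
  then show "u \<in> radial_solutions a b l"
    using liouville_solution_in_radial_solutions[OF assms(1,2)] by auto
qed

theorem theorem6:
  fixes a b :: real
  assumes "0 < a" and "a < b"
  shows "\<exists>lstar>0.
    (\<forall>l>lstar. radial_solutions a b l = {}) \<and>
    (\<exists>!v. v \<in> radial_solutions a b lstar) \<and>
    (\<exists>(u :: real \<Rightarrow> real^2 \<Rightarrow> real) (U :: real \<Rightarrow> real^2 \<Rightarrow> real) (\<delta> :: real \<Rightarrow> real).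
      (\<forall>l. 0 < l \<and> l < lstar \<longrightarrow>
         radial_solutions a b l = {u l, U l} \<and> u l \<noteq> U l \<and>
         (\<forall>x\<in>closure (annulus a b). u l x \<le> U l x) \<and>
         \<delta> l > 0 \<and> l * (\<delta> l)\<^sup>2 * exp (Linf_norm_on (annulus a b) (U l)) = 1) \<and>
      ((\<lambda>l. l * (\<integral>x. exp (u l x) / (norm x)\<^sup>2 \<partial>lebesgue_on (annulus a b))) \<longlongrightarrow> 0)
        (at_right 0) \<and>
      filterlim (\<lambda>l. l * (\<integral>x. exp (U l x) / (norm x)\<^sup>2 \<partial>lebesgue_on (annulus a b)))
        at_top (at_right 0) \<and>
      uniform_limit (closure (annulus a b)) u (\<lambda>x. 0) (at_right 0) \<and>
      (\<delta> \<longlongrightarrow> 0) (at_right 0) \<and>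
      converges_C1_loc (\<lambda>l. rescaled a b (U l) (\<delta> l)) (\<lambda>l. rescaled_interval a b (\<delta> l))
        (\<lambda>t. ln (4 * exp (sqrt 2 * t) / (1 + exp (sqrt 2 * t))\<^sup>2)) (at_right 0) \<and>
      uniform_limit (closure (annulus a b)) (\<lambda>l x. \<delta> l * U l x)
        (\<lambda>x. 2 * sqrt 2 * green (- ln b) (- ln a) (- ln (norm x)) (- ln (sqrt (a * b))))
        (at_right 0))"
proof -
  note ab = assms
  let ?A = "annulus a b" and ?F = "at_right (0::real)"
  define L where "L = half_width a b"
  have L: "0 < L" unfolding L_def by (rule half_width_pos[OF ab])
  obtain lstar :: real and C1 C2 :: "real \<Rightarrow> real" where lstar: "0 < lstar"
    and none: "\<And>l. lstar < l \<Longrightarrow> {c. 0 < c \<and> 2 * (c / cosh (c * L))\<^sup>2 = l} = {}"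
    and one: "\<exists>m. {c. 0 < c \<and> 2 * (c / cosh (c * L))\<^sup>2 = lstar} = {m}"
    and two: "\<And>l. 0 < l \<Longrightarrow> l < lstar \<Longrightarrow> 0 < C1 l \<and> C1 l < C2 l \<and>
           {c. 0 < c \<and> 2 * (c / cosh (c * L))\<^sup>2 = l} = {C1 l, C2 l}"
    and lim1: "(C1 \<longlongrightarrow> 0) ?F" and lim2: "filterlim C2 at_top ?F"
    by (rule liouville_branches[OF L]) blast
  define u U \<delta> where "u l = liouville_solution a b (C1 l)" and "U l = liouville_solution a b (C2 l)"
    and "\<delta> l = 1 / (sqrt 2 * C2 l)" for l
  have small: "\<forall>\<^sub>F l in ?F. 0 < l \<and> l < lstar"
    using lstar by (auto simp: eventually_at_right)
  have param: "0 < C1 l" "0 < C2 l" "2 * (C1 l / cosh (C1 l * L))\<^sup>2 = l"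
      "2 * (C2 l / cosh (C2 l * L))\<^sup>2 = l" if "0 < l" "l < lstar" for l
  proof -
    from two[OF that] have "{c. 0 < c \<and> 2 * (c / cosh (c * L))\<^sup>2 = l} = {C1 l, C2 l}"
      by (elim conjE)
    then have "C1 l \<in> {c. 0 < c \<and> 2 * (c / cosh (c * L))\<^sup>2 = l}"
      and "C2 l \<in> {c. 0 < c \<and> 2 * (c / cosh (c * L))\<^sup>2 = l}"
      by (simp_all only: insert_iff simp_thms)
    then show "0 < C1 l" "0 < C2 l" "2 * (C1 l / cosh (C1 l * L))\<^sup>2 = l"
      "2 * (C2 l / cosh (C2 l * L))\<^sup>2 = l"
      unfolding mem_Collect_eq by blast+
  qed

  have A: "radial_solutions a b l = {}" if "lstar < l" for l
    using radial_solutions_eq[OF ab, of l] none[OF that] that lstar by (simp add: L_def)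
  have B: "\<exists>!v. v \<in> radial_solutions a b lstar"
  proof -
    obtain m where "{c. 0 < c \<and> 2 * (c / cosh (c * L))\<^sup>2 = lstar} = {m}" using one by blast
    then have "radial_solutions a b lstar = {liouville_solution a b m}"
      by (simp only: radial_solutions_eq[OF ab lstar] L_def image_insert image_empty)
    then show ?thesis by simp
  qed
  have C: "\<forall>l. 0 < l \<and> l < lstar \<longrightarrow> radial_solutions a b l = {u l, U l} \<and> u l \<noteq> U l \<and>
      (\<forall>x\<in>closure ?A. u l x \<le> U l x) \<and>
      \<delta> l > 0 \<and> l * (\<delta> l)\<^sup>2 * exp (Linf_norm_on ?A (U l)) = 1"
  proof (intro allI impI conjI; elim conjE)
    fix l assume l: "0 < l" "l < lstar"
    show "radial_solutions a b l = {u l, U l}"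
      using two[OF l, THEN conjunct2, THEN conjunct2]
      by (simp only: radial_solutions_eq[OF ab l(1)] L_def u_def U_def image_insert image_empty)
    \<comment> \<open>the two solutions are told apart by their maxima\<close>
    have normU: "Linf_norm_on ?A (U l) = 2 * ln (cosh (C2 l * L))"
      using Linf_norm_liouville_solution[OF ab, of "C2 l"] param[OF l] by (simp add: U_def L_def)
    have normu: "Linf_norm_on ?A (u l) = 2 * ln (cosh (C1 l * L))"
      using Linf_norm_liouville_solution[OF ab, of "C1 l"] param[OF l] by (simp add: u_def L_def)
    have "cosh (C1 l * L) < cosh (C2 l * L)"
      using two[OF l] L by (subst cosh_real_nonneg_less_iff) auto
    then have "Linf_norm_on ?A (u l) < Linf_norm_on ?A (U l)"
      unfolding normU normu by simp
    then show "u l \<noteq> U l" by auto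
    show "\<forall>x\<in>closure ?A. u l x \<le> U l x"
      using liouville_profile_mono[OF _ _ log_polar_bounds(2)[OF ab], of "C1 l" "C2 l"] two[OF l]
      by (simp add: u_def U_def liouville_solution_eq[OF ab])
    show "\<delta> l > 0" using param[OF l] by (simp add: \<delta>_def)
    have "exp (Linf_norm_on ?A (U l)) = (cosh (C2 l * L))\<^sup>2" by (simp add: normU exp_double)
    moreover have "2 * (C2 l / cosh (C2 l * L))\<^sup>2 * (\<delta> l)\<^sup>2 * (cosh (C2 l * L))\<^sup>2 = 1"
      using param(2)[OF l] by (simp add: \<delta>_def power_divide power_mult_distrib)
    ultimately show "l * (\<delta> l)\<^sup>2 * exp (Linf_norm_on ?A (U l)) = 1"
      by (simp only: param(4)[OF l])
  qed
  have \<delta>: "(\<delta> \<longlongrightarrow> 0) ?F"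
  proof -
    have "filterlim (\<lambda>l. sqrt 2 * C2 l) at_top ?F"
      by (rule filterlim_tendsto_pos_mult_at_top[OF tendsto_const _ lim2]) simp
    then show ?thesis unfolding \<delta>_def [abs_def]
      by (rule tendsto_divide_0[OF tendsto_const filterlim_at_top_imp_at_infinity])
  qed
  have mass_u: "((\<lambda>l. l * (\<integral>x. exp (u l x) / (norm x)\<^sup>2 \<partial>lebesgue_on ?A)) \<longlongrightarrow> 0) ?F"
  proof (rule tendsto_sandwich)
    let ?K = "pi * (b\<^sup>2 - a\<^sup>2) / a\<^sup>2"
    show "\<forall>\<^sub>F l in ?F. 0 \<le> l * (\<integral>x. exp (u l x) / (norm x)\<^sup>2 \<partial>lebesgue_on ?A)"
      using small by (rule eventually_mono) simp
    show "\<forall>\<^sub>F l in ?F. l * (\<integral>x. exp (u l x) / (norm x)\<^sup>2 \<partial>lebesgue_on ?A) \<le> 2 * (C1 l)\<^sup>2 * ?K"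
      using small
    proof (rule eventually_mono)
      fix l assume "0 < l \<and> l < lstar"
      then have l: "0 < l" "l < lstar" by auto
      show "l * (\<integral>x. exp (u l x) / (norm x)\<^sup>2 \<partial>lebesgue_on ?A) \<le> 2 * (C1 l)\<^sup>2 * ?K"
        using liouville_solution_mass_upper[OF ab less_imp_le[OF param(1)[OF l]]]
        unfolding L_def[symmetric] param(3)[OF l] u_def .
    qed
    have "((\<lambda>l. 2 * (C1 l)\<^sup>2 * ?K) \<longlongrightarrow> 2 * 0\<^sup>2 * ?K) ?F"
      by (intro tendsto_intros lim1)
    then show "((\<lambda>l. 2 * (C1 l)\<^sup>2 * ?K) \<longlongrightarrow> 0) ?F" by simp
  qed simp
  have mass_U: "filterlim (\<lambda>l. l * (\<integral>x. exp (U l x) / (norm x)\<^sup>2 \<partial>lebesgue_on ?A)) at_top ?F"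
  proof (rule filterlim_at_top_mono)
    let ?K = "4 * pi * a / (b * (cosh 1)\<^sup>2)"
    have "0 < ?K" using ab by simp
    then show "filterlim (\<lambda>l. ?K * C2 l) at_top ?F"
      by (rule filterlim_tendsto_pos_mult_at_top[OF tendsto_const _ lim2])
    have "\<forall>\<^sub>F l in ?F. 1 / L \<le> C2 l" using lim2 by (auto simp: filterlim_at_top)
    with small show "\<forall>\<^sub>F l in ?F. ?K * C2 l \<le> l * (\<integral>x. exp (U l x) / (norm x)\<^sup>2 \<partial>lebesgue_on ?A)"
    proof eventually_elim
      case (elim l)
      then have l: "0 < l" "l < lstar" by auto
      have "1 / C2 l \<le> L" using elim(2) param(2)[OF l] L by (simp add: field_simps)
      from liouville_solution_mass_lower[OF ab param(2)[OF l] this[unfolded L_def]]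
      show ?case unfolding L_def[symmetric] param(4)[OF l] U_def .
    qed
  qed
  have unif_u: "uniform_limit (closure ?A) u (\<lambda>x. 0) ?F"
  proof (rule uniform_limitI)
    fix \<epsilon> :: real assume "0 < \<epsilon>"
    have "((\<lambda>l. 2 * ln (cosh (C1 l * L))) \<longlongrightarrow> 2 * ln (cosh (0 * L))) ?F"
      by (intro tendsto_intros lim1) auto
    then have "\<forall>\<^sub>F l in ?F. 2 * ln (cosh (C1 l * L)) < \<epsilon>"
      using \<open>0 < \<epsilon>\<close> by (intro order_tendstoD(2)) auto
    with small show "\<forall>\<^sub>F l in ?F. \<forall>x\<in>closure ?A. dist (u l x) 0 < \<epsilon>"
    proof eventually_elim
      case (elim l)
      show ?case
      proof
        fix x assume x: "x \<in> closure ?A"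
        have "0 \<le> C1 l" using param(1)[of l] elim by simp
        from liouville_profile_bounds[OF this log_polar_bounds(2)[OF ab x]]
        show "dist (u l x) 0 < \<epsilon>"
          using elim(2) x by (simp add: u_def liouville_solution_eq[OF ab] L_def dist_real_def)
      qed
    qed
  qed
  have bubble: "converges_C1_loc (\<lambda>l. rescaled a b (U l) (\<delta> l)) (\<lambda>l. rescaled_interval a b (\<delta> l))
        (\<lambda>t. ln (4 * exp (sqrt 2 * t) / (1 + exp (sqrt 2 * t))\<^sup>2)) ?F"
  proof (rule converges_C1_loc_rescaled[OF ab \<delta>])
    show "\<forall>\<^sub>F l in ?F. 0 < \<delta> l" using small by (rule eventually_mono) (simp add: \<delta>_def param(2))
    show "\<forall>\<^sub>F l in ?F. \<forall>t\<in>rescaled_interval a b (\<delta> l). rescaled a b (U l) (\<delta> l) t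
        = ln (4 * exp (sqrt 2 * t) / (1 + exp (sqrt 2 * t))\<^sup>2)"
      using small unfolding U_def \<delta>_def
      by (rule eventually_mono) (use rescaled_liouville_solution[OF ab] param(2) in blast)
    show "(\<lambda>t. ln (4 * exp (sqrt 2 * t) / (1 + exp (sqrt 2 * t))\<^sup>2)) differentiable (at t)" for t
      unfolding bubble_eq_ln_cosh real_differentiable_def
      by (rule exI, (rule derivative_eq_intros refl | simp)+)
  qed
  have tent: "uniform_limit (closure ?A) (\<lambda>l x. \<delta> l * U l x)
        (\<lambda>x. 2 * sqrt 2 * green (- ln b) (- ln a) (- ln (norm x)) (- ln (sqrt (a * b)))) ?F"
  proof (rule uniform_limitI)
    fix \<epsilon> :: real assume "0 < \<epsilon>"
    have "((\<lambda>l. 2 * ln 2 * \<delta> l) \<longlongrightarrow> 2 * ln 2 * 0) ?F" by (intro tendsto_intros \<delta>)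
    then have "\<forall>\<^sub>F l in ?F. 2 * ln 2 * \<delta> l < \<epsilon>"
      using \<open>0 < \<epsilon>\<close> by (intro order_tendstoD(2)) auto
    with small show "\<forall>\<^sub>F l in ?F. \<forall>x\<in>closure ?A. dist (\<delta> l * U l x)
        (2 * sqrt 2 * green (- ln b) (- ln a) (- ln (norm x)) (- ln (sqrt (a * b)))) < \<epsilon>"
    proof eventually_elim
      case (elim l)
      then have "0 < C2 l" using param(2) by blast
      from liouville_solution_green_distance[OF ab this] elim(2)
      show ?case by (force simp: dist_real_def \<delta>_def U_def)
    qed
  qed
  show ?thesis
  proof (rule exI[of _ lstar], intro conjI)
    show "\<forall>l>lstar. radial_solutions a b l = {}" using A by blast
  qed (fact lstar B | rule exI[of _ u], rule exI[of _ U], rule exI[of _ \<delta>],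
       intro conjI C mass_u mass_U unif_u \<delta> bubble tent)+
qed

end
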